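(* Let $\gamma=\pi\circ\lambda:[0,T]\to\mathbb{R}^5$ be a normal unit-speed geodesic in the Cartan group $\mathfrak{C}$; write $h_i(t)=h_i(\lambda(t))$. (1) If $h_3$ is not identically equal to zero, then $\gamma$ is equiregular at $t\in[0,T]$ if and only if $h_3(t)\ne0$. Moreover, $\gamma$ is ample and its growth vector is $$\mathcal{G}_\gamma(t)=\begin{cases}(2,3,4,5)&\text{if }h_3(t)\ne0,\\(2,3,4,4,5)&\text{if }h_3(t)=0.\end{cases}$$ (2) If $h_3\equiv0$, then $\gamma$ is not ample, and it is an abnormal geodesic.
   Context: The Cartan group. $\mathfrak{C}$ is the simply connected nilpotent Lie group, with underlying manifold $\mathbb{R}^5$, whose Lie algebra of left-invariant vector fields is $\mathrm{span}\{X_1,\dots,X_5\}$ with $[X_1,X_2]=X_3$, $[X_1,X_3]=X_4$, $[X_2,X_3]=X_5$ and all other brackets zero. It carries the sub-Riemannian structure $\mathscr{D}=\mathrm{span}\{X_1,X_2\}$ with $X_1,X_2$ orthonormal. Normal and abnormal geodesics. $h_i(\lambda)=\langle\lambda,X_i\rangle$ for $\lambda\in T^*\mathbb{R}^5$, $H=\frac12(h_1^2+h_2^2)$; for a function $a$, $\vec a$ is its Hamiltonian vector field, $da=\sigma(\cdot,\vec a)$, $\sigma$ the differential of the Liouville form; $\pi:T^*\mathbb{R}^5\to\mathbb{R}^5$ is the projection. A normal geodesic is $\gamma=\pi\circ\lambda$ with $\dot\lambda=\vec H(\lambda)$; it is unit-speed when $h_1^2+h_2^2=1$ along $\lambda$.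 A geodesic $\gamma$ with $\dot\gamma=u_1X_1+u_2X_2$ is abnormal if there is a nowhere-zero Lipschitz curve $\eta(t)\in T^*_{\gamma(t)}\mathbb{R}^5$ with $\dot\eta=u_1\vec h_1(\eta)+u_2\vec h_2(\eta)$ and $h_1(\eta)=h_2(\eta)=0$ (a geodesic may be both normal and abnormal). Flag. For a smooth admissible curve $\gamma$ choose a horizontal vector field $\mathsf T$ with $\mathsf T|_{\gamma(t)}=\dot\gamma(t)$. The flag is $\mathscr{F}^i_\gamma(t)=\mathrm{span}\{\mathcal{L}^j_{\mathsf T}(X)|_{\gamma(t)}: X\text{ a horizontal vector field},\ j\le i-1\}\subset T_{\gamma(t)}\mathbb{R}^5$ (independent of $\mathsf T$), where $\mathcal L_{\mathsf T}$ is the Lie derivative, and the growth vector is $\mathcal{G}_\gamma(t)=(k_1(t),k_2(t),\dots)$, $k_i(t)=\dim\mathscr{F}^i_\gamma(t)$, written up to the first entry equal to $5$. $\gamma$ is equiregular at $t$ if its growth vector is locally constant at $t$, and ample at $t$ if $\mathscr{F}^m_\gamma(t)=T_{\gamma(t)}\mathbb{R}^5$ for some $m$; it is ample if it is ample at every $t\in[0,T]$. *)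

theory Defs
  imports "HOL-Analysis.Analysis"
begin

section \<open>Smooth maps, Lie brackets\<close>

text \<open>The domain is finite-dimensional, so smoothness may be tested on directional derivatives.\<close>

primrec C_k :: "nat \<Rightarrow> ('a::euclidean_space \<Rightarrow> 'b::real_normed_vector) \<Rightarrow> bool" where
  "C_k 0 f \<longleftrightarrow> continuous_on UNIV f"
| "C_k (Suc k) f \<longleftrightarrow>
     (\<exists>f'. (\<forall>x. (f has_derivative f' x) (at x)) \<and> (\<forall>v. C_k k (\<lambda>x. f' x v)))"

definition smooth :: "('a::euclidean_space \<Rightarrow> 'b::real_normed_vector) \<Rightarrow> bool" where
  "smooth f \<longleftrightarrow> (\<forall>k. C_k k f)"

type_synonym vfield = "real^5 \<Rightarrow> real^5"

text \<open>As derivations, \<open>[V, W] = V W - W V\<close>; this is also the Lie derivative of \<open>W\<close> along \<open>V\<close>.\<close>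

definition lie_bracket :: "vfield \<Rightarrow> vfield \<Rightarrow> vfield" where
  "lie_bracket V W =
     (\<lambda>x. frechet_derivative W (at x) (V x) - frechet_derivative V (at x) (W x))"


section \<open>The Cartan group\<close>

definition left_invariant :: "(real^5 \<Rightarrow> real^5 \<Rightarrow> real^5) \<Rightarrow> vfield \<Rightarrow> bool" where
  "left_invariant gmul V \<longleftrightarrow>
     (\<forall>g x. frechet_derivative (gmul g) (at x) (V x) = V (gmul g x))"

text \<open>
  A Lie group structure on \<open>\<real>\<^sup>5\<close> together with a basis \<open>X 1, \<dots>, X 5\<close> of its Lie algebra of
  left-invariant vector fields satisfying the bracket relations. No coordinates are chosen: any such
  structure is allowed. Left-invariant fields form a five-dimensional space, so left-invariant
  fields that frame the tangent spaces are a basis of it. Connectedness and simple connectedness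
  are those of \<open>\<real>\<^sup>5\<close>; nilpotency is read off from the brackets.
\<close>

locale cartan_group = Groups.group gmul e ginv
  for gmul :: "real^5 \<Rightarrow> real^5 \<Rightarrow> real^5" and e :: "real^5" and ginv :: "real^5 \<Rightarrow> real^5" +
  fixes X :: "nat \<Rightarrow> vfield"
  assumes smooth_mult: "smooth (\<lambda>(x, y). gmul x y)"
    and smooth_inv: "smooth ginv"
    and smooth_X: "\<And>i. i \<in> {1..5} \<Longrightarrow> smooth (X i)"
    and left_invariant_X: "\<And>i. i \<in> {1..5} \<Longrightarrow> left_invariant gmul (X i)"
    and frame_X: "\<And>x. span {X 1 x, X 2 x, X 3 x, X 4 x, X 5 x} = UNIV"
    and bracket_12: "lie_bracket (X 1) (X 2) = X 3"
    and bracket_13: "lie_bracket (X 1) (X 3) = X 4"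
    and bracket_23: "lie_bracket (X 2) (X 3) = X 5"
    and bracket_14: "lie_bracket (X 1) (X 4) = (\<lambda>x. 0)"
    and bracket_15: "lie_bracket (X 1) (X 5) = (\<lambda>x. 0)"
    and bracket_24: "lie_bracket (X 2) (X 4) = (\<lambda>x. 0)"
    and bracket_25: "lie_bracket (X 2) (X 5) = (\<lambda>x. 0)"
    and bracket_34: "lie_bracket (X 3) (X 4) = (\<lambda>x. 0)"
    and bracket_35: "lie_bracket (X 3) (X 5) = (\<lambda>x. 0)"
    and bracket_45: "lie_bracket (X 4) (X 5) = (\<lambda>x. 0)"


section \<open>Symplectic structure of the cotangent bundle\<close>

text \<open>
  A point of \<open>T\<^sup>*\<real>\<^sup>5\<close> is a pair \<open>(x, p)\<close>, the covector \<open>p\<close> acting on tangent vectors by the inner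
  product; the projection to the base is \<^const>\<open>fst\<close>.
\<close>

type_synonym cotangent = "(real^5) \<times> (real^5)"

definition liouville :: "cotangent \<Rightarrow> cotangent \<Rightarrow> real" where
  "liouville z v = snd z \<bullet> fst v"

text \<open>
  \<open>d\<theta>(v, w) = v(\<theta>(w)) - w(\<theta>(v))\<close> for constant vector fields \<open>v\<close>, \<open>w\<close>.
\<close>

definition symplectic :: "cotangent \<Rightarrow> cotangent \<Rightarrow> cotangent \<Rightarrow> real" where
  "symplectic z v w =
     frechet_derivative (\<lambda>y. liouville y w) (at z) v -
     frechet_derivative (\<lambda>y. liouville y v) (at z) w"

definition hamiltonian_field :: "(cotangent \<Rightarrow> real) \<Rightarrow> cotangent \<Rightarrow> cotangent" where
  "hamiltonian_field a z =
     (THE w. \<forall>v. frechet_derivative a (at z) v = symplectic z v w)"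

definition h :: "(nat \<Rightarrow> vfield) \<Rightarrow> nat \<Rightarrow> cotangent \<Rightarrow> real" where
  "h X i z = snd z \<bullet> X i (fst z)"

definition hamiltonian :: "(nat \<Rightarrow> vfield) \<Rightarrow> cotangent \<Rightarrow> real" where
  "hamiltonian X z = ((h X 1 z)\<^sup>2 + (h X 2 z)\<^sup>2) / 2"


section \<open>Normal and abnormal geodesics\<close>

definition normal_extremal :: "(nat \<Rightarrow> vfield) \<Rightarrow> real \<Rightarrow> (real \<Rightarrow> cotangent) \<Rightarrow> bool" where
  "normal_extremal X T l \<longleftrightarrow>
     (\<forall>t\<in>{0..T}. (l has_vector_derivative hamiltonian_field (hamiltonian X) (l t))
                    (at t within {0..T}))"

definition unit_speed :: "(nat \<Rightarrow> vfield) \<Rightarrow> real \<Rightarrow> (real \<Rightarrow> cotangent) \<Rightarrow> bool" where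
  "unit_speed X T l \<longleftrightarrow> (\<forall>t\<in>{0..T}. (h X 1 (l t))\<^sup>2 + (h X 2 (l t))\<^sup>2 = 1)"

text \<open>
  The differential equations hold almost everywhere, as usual for Lipschitz curves. To be applied
  to curves \<open>\<gamma>\<close> already known to be geodesics.
\<close>

definition abnormal :: "(nat \<Rightarrow> vfield) \<Rightarrow> real \<Rightarrow> (real \<Rightarrow> real^5) \<Rightarrow> bool" where
  "abnormal X T \<gamma> \<longleftrightarrow>
     (\<exists>(u1 :: real \<Rightarrow> real) (u2 :: real \<Rightarrow> real) (\<eta> :: real \<Rightarrow> cotangent) C.
        C-lipschitz_on {0..T} \<eta> \<and>
        (\<forall>t\<in>{0..T}. fst (\<eta> t) = \<gamma> t \<and> snd (\<eta> t) \<noteq> 0 \<and> h X 1 (\<eta> t) = 0 \<and> h X 2 (\<eta> t) = 0) \<and>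
        (AE t\<in>{0..T} in lebesgue.
           (\<gamma> has_vector_derivative u1 t *\<^sub>R X 1 (\<gamma> t) + u2 t *\<^sub>R X 2 (\<gamma> t))
             (at t within {0..T}) \<and>
           (\<eta> has_vector_derivative
              u1 t *\<^sub>R hamiltonian_field (h X 1) (\<eta> t) + u2 t *\<^sub>R hamiltonian_field (h X 2) (\<eta> t))
             (at t within {0..T})))"


section \<open>Flag and growth vector\<close>

definition horizontal :: "(nat \<Rightarrow> vfield) \<Rightarrow> vfield \<Rightarrow> bool" where
  "horizontal X V \<longleftrightarrow> smooth V \<and> (\<forall>x. V x \<in> span {X 1 x, X 2 x})"

definition extends_velocity :: "(nat \<Rightarrow> vfield) \<Rightarrow> real \<Rightarrow> (real \<Rightarrow> real^5) \<Rightarrow> vfield \<Rightarrow> bool" where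
  "extends_velocity X T \<gamma> V \<longleftrightarrow> horizontal X V \<and>
     (\<forall>t\<in>{0..T}. V (\<gamma> t) = vector_derivative \<gamma> (at t within {0..T}))"

text \<open>\<open>\<F>\<^sup>i\<close> is indexed from \<open>i = 1\<close>; the condition \<open>j < i\<close> is \<open>j \<le> i - 1\<close>.\<close>

definition flag_along :: "(nat \<Rightarrow> vfield) \<Rightarrow> vfield \<Rightarrow> nat \<Rightarrow> real^5 \<Rightarrow> (real^5) set" where
  "flag_along X V i x = span {((lie_bracket V ^^ j) W) x | W j. horizontal X W \<and> j < i}"

text \<open>
  The flag does not depend on the extension \<open>V\<close>. For a normal extremal an extension exists on all
  of \<open>\<real>\<^sup>5\<close>: transport the initial covector to a right-invariant one-form, which contains the
  extremal, and use its values on \<open>X 1\<close> and \<open>X 2\<close> as the coefficients of \<open>V\<close>.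
\<close>

definition flag :: "(nat \<Rightarrow> vfield) \<Rightarrow> real \<Rightarrow> (real \<Rightarrow> real^5) \<Rightarrow> nat \<Rightarrow> real \<Rightarrow> (real^5) set" where
  "flag X T \<gamma> i t = flag_along X (SOME V. extends_velocity X T \<gamma> V) i (\<gamma> t)"

definition growth :: "(nat \<Rightarrow> vfield) \<Rightarrow> real \<Rightarrow> (real \<Rightarrow> real^5) \<Rightarrow> real \<Rightarrow> nat \<Rightarrow> nat" where
  "growth X T \<gamma> t i = dim (flag X T \<gamma> i t)"

text \<open>The growth vector written up to its first entry \<open>5\<close>; to be used where there is such an entry.\<close>

definition growth_vector :: "(nat \<Rightarrow> vfield) \<Rightarrow> real \<Rightarrow> (real \<Rightarrow> real^5) \<Rightarrow> real \<Rightarrow> nat list" where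
  "growth_vector X T \<gamma> t = map (growth X T \<gamma> t) [1..<Suc (LEAST m. growth X T \<gamma> t m = 5)]"

definition equiregular_at :: "(nat \<Rightarrow> vfield) \<Rightarrow> real \<Rightarrow> (real \<Rightarrow> real^5) \<Rightarrow> real \<Rightarrow> bool" where
  "equiregular_at X T \<gamma> t \<longleftrightarrow>
     (\<forall>\<^sub>F s in at t within {0..T}. \<forall>i\<ge>1. growth X T \<gamma> s i = growth X T \<gamma> t i)"

definition ample_at :: "(nat \<Rightarrow> vfield) \<Rightarrow> real \<Rightarrow> (real \<Rightarrow> real^5) \<Rightarrow> real \<Rightarrow> bool" where
  "ample_at X T \<gamma> t \<longleftrightarrow> (\<exists>m\<ge>1. flag X T \<gamma> m t = UNIV)"

definition ample :: "(nat \<Rightarrow> vfield) \<Rightarrow> real \<Rightarrow> (real \<Rightarrow> real^5) \<Rightarrow> bool" where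
  "ample X T \<gamma> \<longleftrightarrow> (\<forall>t\<in>{0..T}. ample_at X T \<gamma> t)"


section \<open>Consistency checks\<close>

lemma symplectic_eq: "symplectic z v w = snd v \<bullet> fst w - snd w \<bullet> fst v"
proof -
  have "((\<lambda>y. liouville y u) has_derivative (\<lambda>y. snd y \<bullet> fst u)) (at z)" for u
    unfolding liouville_def by (auto intro!: derivative_eq_intros)
  then have "frechet_derivative (\<lambda>y. liouville y u) (at z) = (\<lambda>y. snd y \<bullet> fst u)" for u
    by (rule frechet_derivative_at[symmetric])
  then show ?thesis
    by (simp add: symplectic_def)
qed

text \<open>Hamilton's equations: \<open>\<partial>a/\<partial>p = P\<close> and \<open>\<partial>a/\<partial>x = Q\<close> give the field \<open>(P, - Q)\<close>.\<close>

lemma hamiltonian_field_eq: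
  assumes "(a has_derivative (\<lambda>v. fst v \<bullet> Q + snd v \<bullet> P)) (at z)"
  shows "hamiltonian_field a z = (P, - Q)"
proof -
  have d: "frechet_derivative a (at z) = (\<lambda>v. fst v \<bullet> Q + snd v \<bullet> P)"
    using assms by (rule frechet_derivative_at[symmetric])
  show ?thesis
    unfolding hamiltonian_field_def d symplectic_eq
  proof (rule the_equality)
    show "\<forall>v. fst v \<bullet> Q + snd v \<bullet> P = snd v \<bullet> fst (P, - Q) - snd (P, - Q) \<bullet> fst v"
      by (simp add: inner_commute)
  next
    fix w :: cotangent
    assume w: "\<forall>v. fst v \<bullet> Q + snd v \<bullet> P = snd v \<bullet> fst w - snd w \<bullet> fst v"
    have "y \<bullet> P = y \<bullet> fst w" for y
      using w[rule_format, of "(0, y)"] by simp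
    then have "P = fst w"
      by (rule vector_eq_ldot[THEN iffD1, OF allI])
    moreover have "y \<bullet> Q = y \<bullet> (- snd w)" for y
      using w[rule_format, of "(y, 0)"] by (simp add: inner_commute)
    then have "Q = - snd w"
      by (rule vector_eq_ldot[THEN iffD1, OF allI])
    ultimately show "w = (P, - Q)"
      by (simp add: prod_eq_iff)
  qed
qed

lemma C_k_Suc_imp: "C_k (Suc k) f \<Longrightarrow> C_k k f"
proof (induction k arbitrary: f)
  case 0
  then obtain f' where "\<And>x. (f has_derivative f' x) (at x)"
    unfolding C_k.simps by blast
  then show ?case
    unfolding C_k.simps continuous_on_eq_continuous_within
    by (blast intro: has_derivative_continuous)
next
  case (Suc k)
  from Suc.prems obtain f' where
    "\<And>x. (f has_derivative f' x) (at x)" "\<And>v. C_k (Suc k) (\<lambda>x. f' x v)"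
    unfolding C_k.simps(2)[of "Suc k" f] by blast
  then show ?case
    unfolding C_k.simps(2)[of k f] using Suc.IH by blast
qed

lemma C_k_const: "C_k k (\<lambda>x. c)"
proof (induction k arbitrary: c)
  case (Suc k)
  show ?case
    unfolding C_k.simps by (rule exI[of _ "\<lambda>x v. 0"]) (simp add: Suc)
qed simp

lemma C_k_bounded_linear:
  assumes "bounded_linear f"
  shows "C_k k f"
proof (cases k)
  case 0
  show ?thesis
    unfolding 0 C_k.simps by (rule linear_continuous_on[OF assms])
next
  case (Suc j)
  show ?thesis
    unfolding Suc C_k.simps
    by (rule exI[of _ "\<lambda>x. f"])
      (simp add: C_k_const bounded_linear_imp_has_derivative[OF assms])
qed

lemma C_k_add: "C_k k f \<Longrightarrow> C_k k g \<Longrightarrow> C_k k (\<lambda>x. f x + g x)"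
proof (induction k arbitrary: f g)
  case 0
  then show ?case by (simp add: continuous_on_add)
next
  case (Suc k)
  from Suc.prems obtain f' g' where d:
    "\<And>x. (f has_derivative f' x) (at x)" "\<And>v. C_k k (\<lambda>x. f' x v)"
    "\<And>x. (g has_derivative g' x) (at x)" "\<And>v. C_k k (\<lambda>x. g' x v)"
    unfolding C_k.simps by blast
  have "((\<lambda>x. f x + g x) has_derivative (\<lambda>v. f' x v + g' x v)) (at x)" for x
    by (rule has_derivative_add[OF d(1) d(3)])
  moreover have "C_k k (\<lambda>x. f' x v + g' x v)" for v
    by (rule Suc.IH[OF d(2) d(4)])
  ultimately show ?case
    unfolding C_k.simps by (intro exI[of _ "\<lambda>x v. f' x v + g' x v"]) simp
qed

lemma C_k_scaleR:
  fixes f :: "'a::euclidean_space \<Rightarrow> real" and g :: "'a \<Rightarrow> 'b::real_normed_vector"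
  shows "C_k k f \<Longrightarrow> C_k k g \<Longrightarrow> C_k k (\<lambda>x. f x *\<^sub>R g x)"
proof (induction k arbitrary: f g)
  case 0
  then show ?case by (simp add: continuous_on_scaleR)
next
  case (Suc k)
  from Suc.prems obtain f' g' where d:
    "\<And>x. (f has_derivative f' x) (at x)" "\<And>v. C_k k (\<lambda>x. f' x v)"
    "\<And>x. (g has_derivative g' x) (at x)" "\<And>v. C_k k (\<lambda>x. g' x v)"
    unfolding C_k.simps by blast
  have fg: "C_k k f" "C_k k g"
    using Suc.prems by (blast intro: C_k_Suc_imp)+
  have "((\<lambda>x. f x *\<^sub>R g x) has_derivative (\<lambda>v. f x *\<^sub>R g' x v + f' x v *\<^sub>R g x)) (at x)" for x
    by (rule has_derivative_scaleR[OF d(1) d(3)])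
  moreover have "C_k k (\<lambda>x. f x *\<^sub>R g' x v + f' x v *\<^sub>R g x)" for v
    by (rule C_k_add[OF Suc.IH[OF fg(1) d(4)] Suc.IH[OF d(2) fg(2)]])
  ultimately show ?case
    unfolding C_k.simps by (intro exI[of _ "\<lambda>x v. f x *\<^sub>R g' x v + f' x v *\<^sub>R g x"]) simp
qed

lemma smooth_const: "smooth (\<lambda>x. c)"
  by (simp add: smooth_def C_k_const)

lemma smooth_bounded_linear: "bounded_linear f \<Longrightarrow> smooth f"
  by (simp add: smooth_def C_k_bounded_linear)

lemma smooth_add: "smooth f \<Longrightarrow> smooth g \<Longrightarrow> smooth (\<lambda>x. f x + g x)"
  by (simp add: smooth_def C_k_add)

lemma smooth_scaleR: "smooth f \<Longrightarrow> smooth g \<Longrightarrow> smooth (\<lambda>x. f x *\<^sub>R g x)"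
  by (simp add: smooth_def C_k_scaleR)

lemma smooth_mult_real: "smooth f \<Longrightarrow> smooth g \<Longrightarrow> smooth (\<lambda>x. f x * g x)"
  for f g :: "'a::euclidean_space \<Rightarrow> real"
  using smooth_scaleR[of f g] by simp

definition vec5 :: "real \<Rightarrow> real \<Rightarrow> real \<Rightarrow> real \<Rightarrow> real \<Rightarrow> real^5" where
  "vec5 a b c d e =
     a *\<^sub>R axis 1 1 + b *\<^sub>R axis 2 1 + c *\<^sub>R axis 3 1 + d *\<^sub>R axis 4 1 + e *\<^sub>R axis 5 1"

definition model_mult :: "real^5 \<Rightarrow> real^5 \<Rightarrow> real^5" where
  "model_mult g x = vec5
     (g $ 1 + x $ 1)
     (g $ 2 + x $ 2)
     (g $ 3 + x $ 3 + g $ 1 * x $ 2)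
     (g $ 4 + x $ 4 + g $ 1 * x $ 3 + 1/2 * (g $ 1 * (g $ 1 * x $ 2)))
     (g $ 5 + x $ 5 + g $ 2 * x $ 3 + 1/2 * (g $ 1 * (x $ 2 * x $ 2)) + g $ 1 * (g $ 2 * x $ 2))"

definition model_inv :: "real^5 \<Rightarrow> real^5" where
  "model_inv g = vec5
     ((-1) * g $ 1)
     ((-1) * g $ 2)
     ((-1) * g $ 3 + g $ 1 * g $ 2)
     ((-1) * g $ 4 + g $ 1 * g $ 3 + (-1/2) * (g $ 1 * (g $ 1 * g $ 2)))
     ((-1) * g $ 5 + g $ 2 * g $ 3 + (-1/2) * (g $ 1 * (g $ 2 * g $ 2)))"

definition model_X :: "nat \<Rightarrow> vfield" where
  "model_X i x =
    (if i = 1 then vec5 1 0 0 0 0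
     else if i = 2 then vec5 0 1 (x $ 1) (1/2 * (x $ 1 * x $ 1)) (x $ 1 * x $ 2)
     else if i = 3 then vec5 0 0 1 (x $ 1) (x $ 2)
     else if i = 4 then vec5 0 0 0 1 0
     else vec5 0 0 0 0 1)"

lemma exhaust_5: "x = 1 \<or> x = 2 \<or> x = 3 \<or> x = 4 \<or> x = 5" for x :: 5
proof (induct x)
  case (of_int z)
  then have "0 \<le> z" and "z < 5" by simp_all
  then have "z = 0 \<or> z = 1 \<or> z = 2 \<or> z = 3 \<or> z = 4" by arith
  then show ?case by auto
qed

lemma forall_5: "(\<forall>i::5. P i) \<longleftrightarrow> P 1 \<and> P 2 \<and> P 3 \<and> P 4 \<and> P 5"
  by (metis exhaust_5)

lemma vec5_eq_iff:
  "v = w \<longleftrightarrow> v $ 1 = w $ 1 \<and> v $ 2 = w $ 2 \<and> v $ 3 = w $ 3 \<and> v $ 4 = w $ 4 \<and> v $ 5 = w $ 5"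
  for v w :: "real^5"
  by (simp add: vec_eq_iff forall_5)

lemma vec5_nth [simp]:
  "vec5 a b c d e $ 1 = a" "vec5 a b c d e $ 2 = b" "vec5 a b c d e $ 3 = c"
  "vec5 a b c d e $ 4 = d" "vec5 a b c d e $ 5 = e"
  by (simp_all add: vec5_def axis_def)

lemma smooth_vec5:
  assumes "smooth a" "smooth b" "smooth c" "smooth d" "smooth e"
  shows "smooth (\<lambda>x. vec5 (a x) (b x) (c x) (d x) (e x))"
  unfolding vec5_def using assms by (intro smooth_add smooth_scaleR smooth_const)

lemma has_derivative_vec5:
  assumes "(a has_derivative a') F" "(b has_derivative b') F" "(c has_derivative c') F"
    "(d has_derivative d') F" "(e has_derivative e') F"
  shows "((\<lambda>x. vec5 (a x) (b x) (c x) (d x) (e x)) has_derivative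
     (\<lambda>v. vec5 (a' v) (b' v) (c' v) (d' v) (e' v))) F"
  unfolding vec5_def using assms
  by (intro has_derivative_add has_derivative_scaleR_left)

lemma has_derivative_nth: "((\<lambda>x::real^5. x $ i) has_derivative (\<lambda>v. v $ i)) F"
  by (rule bounded_linear_imp_has_derivative[OF bounded_linear_vec_nth])

lemma model_mult_derivative:
  "frechet_derivative (model_mult g) (at x) = (\<lambda>v. vec5 (v $ 1) (v $ 2) (v $ 3 + g $ 1 * v $ 2)
     (v $ 4 + g $ 1 * v $ 3 + 1/2 * (g $ 1 * (g $ 1 * v $ 2)))
     (v $ 5 + g $ 2 * v $ 3 + g $ 1 * x $ 2 * v $ 2 + g $ 1 * (g $ 2 * v $ 2)))"
  unfolding model_mult_def
  by (rule frechet_derivative_at[symmetric], rule has_derivative_eq_rhs, rule has_derivative_vec5)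
    (auto intro!: derivative_eq_intros has_derivative_nth simp: fun_eq_iff vec5_eq_iff algebra_simps)

lemma model_X_simps:
  "model_X 1 = (\<lambda>x. vec5 1 0 0 0 0)"
  "model_X 2 = (\<lambda>x. vec5 0 1 (x $ 1) (1/2 * (x $ 1 * x $ 1)) (x $ 1 * x $ 2))"
  "model_X 3 = (\<lambda>x. vec5 0 0 1 (x $ 1) (x $ 2))"
  "model_X 4 = (\<lambda>x. vec5 0 0 0 1 0)"
  "model_X 5 = (\<lambda>x. vec5 0 0 0 0 1)"
  by (simp_all add: model_X_def[abs_def])

lemma model_X_derivative:
  "frechet_derivative (\<lambda>x. vec5 0 1 (x $ 1) (1/2 * (x $ 1 * x $ 1)) (x $ 1 * x $ 2)) (at x) =
     (\<lambda>v. vec5 0 0 (v $ 1) (x $ 1 * v $ 1) (x $ 1 * v $ 2 + x $ 2 * v $ 1))"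
  "frechet_derivative (\<lambda>x. vec5 0 0 1 (x $ 1) (x $ 2)) (at x) = (\<lambda>v. vec5 0 0 0 (v $ 1) (v $ 2))"
  for x :: "real^5"
proof -
  have "((\<lambda>x. vec5 0 1 (x $ 1) (1/2 * (x $ 1 * x $ 1)) (x $ 1 * x $ 2)) has_derivative
     (\<lambda>v. vec5 0 0 (v $ 1) (x $ 1 * v $ 1) (x $ 1 * v $ 2 + x $ 2 * v $ 1))) (at x)"
    by (rule has_derivative_eq_rhs, rule has_derivative_vec5)
      (auto intro!: derivative_eq_intros has_derivative_nth simp: fun_eq_iff vec5_eq_iff)
  then show "frechet_derivative (\<lambda>x. vec5 0 1 (x $ 1) (1/2 * (x $ 1 * x $ 1)) (x $ 1 * x $ 2)) (at x) =
     (\<lambda>v. vec5 0 0 (v $ 1) (x $ 1 * v $ 1) (x $ 1 * v $ 2 + x $ 2 * v $ 1))"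
    by (rule frechet_derivative_at[symmetric])
  have "((\<lambda>x. vec5 0 0 1 (x $ 1) (x $ 2)) has_derivative
     (\<lambda>v. vec5 0 0 0 (v $ 1) (v $ 2))) (at x)"
    by (intro has_derivative_vec5 has_derivative_nth has_derivative_const)
  then show "frechet_derivative (\<lambda>x. vec5 0 0 1 (x $ 1) (x $ 2)) (at x) =
     (\<lambda>v. vec5 0 0 0 (v $ 1) (v $ 2))"
    by (rule frechet_derivative_at[symmetric])
qed

text \<open>A realisation, in coordinates, of the Cartan group.\<close>

lemma cartan_group_model: "cartan_group model_mult 0 model_inv model_X"
proof
  have nth: "smooth (\<lambda>x::real^5. x $ i)" for i
    by (rule smooth_bounded_linear[OF bounded_linear_vec_nth])
  have fst: "smooth (\<lambda>z::(real^5) \<times> (real^5). fst z $ i)" for i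
    by (rule smooth_bounded_linear)
      (rule bounded_linear_compose[OF bounded_linear_vec_nth bounded_linear_fst])
  have snd: "smooth (\<lambda>z::(real^5) \<times> (real^5). snd z $ i)" for i
    by (rule smooth_bounded_linear)
      (rule bounded_linear_compose[OF bounded_linear_vec_nth bounded_linear_snd])
  note sm = smooth_vec5 smooth_add smooth_mult_real smooth_const
  show "model_mult (model_mult a b) c = model_mult a (model_mult b c)" for a b c
    by (simp add: model_mult_def vec5_eq_iff algebra_simps)
  show "model_mult 0 a = a" "model_mult (model_inv a) a = 0" for a
    by (simp_all add: model_mult_def model_inv_def vec5_eq_iff algebra_simps)
  show "smooth (\<lambda>(x, y). model_mult x y)"
    unfolding model_mult_def case_prod_beta by (intro sm fst snd)
  show "smooth model_inv"
    unfolding model_inv_def[abs_def] by (intro sm nth)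
  have five: "i = 1 \<or> i = 2 \<or> i = 3 \<or> i = 4 \<or> i = 5" if "i \<in> {1..5}" for i :: nat
    using that by auto
  have "smooth (model_X 1)" "smooth (model_X 2)" "smooth (model_X 3)" "smooth (model_X 4)"
    "smooth (model_X 5)"
    unfolding model_X_simps by (intro sm nth)+
  then show "smooth (model_X i)" if "i \<in> {1..5}" for i
    using five[OF that] by metis
  have "left_invariant model_mult (model_X 1)" "left_invariant model_mult (model_X 2)"
    "left_invariant model_mult (model_X 3)" "left_invariant model_mult (model_X 4)"
    "left_invariant model_mult (model_X 5)"
    unfolding left_invariant_def model_mult_derivative model_X_simps
    by (simp_all add: model_mult_def vec5_eq_iff algebra_simps)
  then show "left_invariant model_mult (model_X i)" if "i \<in> {1..5}" for i
    using five[OF that] by metis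
  show "span {model_X 1 x, model_X 2 x, model_X 3 x, model_X 4 x, model_X 5 x} = UNIV" for x
  proof -
    let ?S = "span {model_X 1 x, model_X 2 x, model_X 3 x, model_X 4 x, model_X 5 x}"
    have "v \<in> ?S" for v
    proof -
      define c where "c = v $ 3 - v $ 2 * x $ 1"
      have "v = v $ 1 *\<^sub>R model_X 1 x + v $ 2 *\<^sub>R model_X 2 x + c *\<^sub>R model_X 3 x
        + (v $ 4 - v $ 2 * (1/2 * (x $ 1 * x $ 1)) - c * x $ 1) *\<^sub>R model_X 4 x
        + (v $ 5 - v $ 2 * (x $ 1 * x $ 2) - c * x $ 2) *\<^sub>R model_X 5 x"
        unfolding model_X_simps by (simp add: vec5_eq_iff c_def)
      also have "\<dots> \<in> ?S"
        by (intro span_add span_scale span_base) auto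
      finally show ?thesis .
    qed
    then show ?thesis by blast
  qed
qed (simp_all only: lie_bracket_def model_X_simps model_X_derivative frechet_derivative_const,
  simp_all add: fun_eq_iff vec5_eq_iff)

end

(*
  The momenta satisfy h1' = - h2 h3, h2' = h1 h3, h3' = h1 h4 + h2 h5, with h4 and h5 constant. Let V be a
  horizontal extension of the velocity. Modulo X1 and X2, a bracket with V turns a field with components
  (z3, z4, z5) along the curve into (z3' + h1 z2 - h2 z1, z4' + h1 z3, z5' + h2 z3). Hence two brackets fill
  X1, X2, X3 and the direction h1 X4 + h2 X5, and the component q along the orthogonal direction
  - h2 X4 + h1 X5 satisfies q(L_V Z) = q(Z)' + h3 r(Z), r being the component along h1 X4 + h2 X5. The third
  bracket therefore reaches q exactly when h3 is nonzero, the fourth one reaches it at zeros of h3 where h3' is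
  nonzero, and no bracket does if h3 vanishes identically. All zeros of h3 are simple by uniqueness for the
  pendulum equation. For h3 = 0 the covector dual to - h2 X4 + h1 X5 is the abnormal lift.

  An extension V exists because right-invariant fields commute with the X i, so that the extremal is the
  restriction to the curve of a right-invariant one-form.
*)
theory Submission
  imports Defs
begin

section \<open>Smooth maps\<close>

text \<open>The group comes without coordinates, so every bracket is computed from pairings with the
  left-invariant coframe dual to the \<open>X i\<close>. The extension \<open>V\<close> is
  prescribed only on the curve and is an arbitrary choice off it. That choice affects only the
  \<open>X 1\<close> and \<open>X 2\<close> components of brackets with \<open>V\<close>, which are
  harmless because these two directions lie in every flag space from the first on. For the other
  components Cartan's formula turns a bracket with \<open>V\<close> into a time derivative along the
  curve plus known terms. Hence each new bracket is found by differentiating an identity already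
  known on all of \<open>{0..T}\<close>; knowing it at a single time would not suffice. The
  commutation of right-invariant fields with the \<open>X i\<close> comes down to the symmetry of
  the second derivatives of the product, which is derived first, from the definition of smoothness
  by directional derivatives.\<close>

lemma smooth_has_derivative:
  assumes "smooth f"
  shows "(f has_derivative frechet_derivative f (at x)) (at x)"
proof -
  have "C_k (Suc 0) f" using assms by (simp only: smooth_def)
  then have "f differentiable (at x)" by (auto simp: differentiable_def)
  then show ?thesis by (simp only: frechet_derivative_works)
qed

lemma smooth_linear_derivative:
  assumes "smooth f"
  shows "linear (frechet_derivative f (at x))"
  using smooth_has_derivative[OF assms] by (rule has_derivative_linear)

lemma C_k_frechet_derivative:
  assumes "C_k (Suc k) f"
  shows "C_k k (\<lambda>x. frechet_derivative f (at x) v)"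
proof -
  obtain f' where f': "\<And>x. (f has_derivative f' x) (at x)" "\<And>v. C_k k (\<lambda>x. f' x v)"
    using assms by auto
  have "frechet_derivative f (at x) = f' x" for x
    by (rule frechet_derivative_at[OF f'(1), symmetric])
  then show ?thesis using f'(2) by simp
qed

lemma smooth_frechet_derivative:
  "smooth f \<Longrightarrow> smooth (\<lambda>x. frechet_derivative f (at x) v)"
  unfolding smooth_def by (blast intro: C_k_frechet_derivative)

lemma smooth_continuous_on: "smooth f \<Longrightarrow> continuous_on S f"
  by (meson C_k.simps(1) continuous_on_subset smooth_def subset_UNIV)

lemma C_k_bounded_linear_comp:
  assumes "bounded_linear L"
  shows "C_k k f \<Longrightarrow> C_k k (\<lambda>x. L (f x))"
proof (induction k arbitrary: f)
  case 0
  then show ?case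
    by (simp add: bounded_linear.continuous_on[OF assms])
next
  case (Suc k)
  from Suc.prems obtain f' where f':
    "\<And>x. (f has_derivative f' x) (at x)" "\<And>v. C_k k (\<lambda>x. f' x v)"
    by auto
  show ?case
    unfolding C_k.simps
    by (rule exI[of _ "\<lambda>x v. L (f' x v)"])
      (use Suc.IH f' in \<open>auto intro: bounded_linear.has_derivative[OF assms]\<close>)
qed

lemma smooth_bounded_linear_comp:
  "bounded_linear L \<Longrightarrow> smooth f \<Longrightarrow> smooth (\<lambda>x. L (f x))"
  by (simp add: smooth_def C_k_bounded_linear_comp)

lemma smooth_ident: "smooth (\<lambda>x. x)"
  by (rule smooth_bounded_linear[OF bounded_linear_ident])

lemma C_k_sum: "(\<And>i. i \<in> I \<Longrightarrow> C_k k (f i)) \<Longrightarrow> C_k k (\<lambda>x. \<Sum>i\<in>I. f i x)"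
  by (induction I rule: infinite_finite_induct) (auto simp: C_k_const C_k_add)

lemma smooth_sum: "(\<And>i. i \<in> I \<Longrightarrow> smooth (f i)) \<Longrightarrow> smooth (\<lambda>x. \<Sum>i\<in>I. f i x)"
  by (simp add: smooth_def C_k_sum)

lemma smooth_minus: "smooth f \<Longrightarrow> smooth (\<lambda>x. - f x)"
  by (rule smooth_bounded_linear_comp[OF bounded_linear_minus[OF bounded_linear_ident]])

lemma smooth_diff: "smooth f \<Longrightarrow> smooth g \<Longrightarrow> smooth (\<lambda>x. f x - g x)"
  using smooth_add[of f "\<lambda>x. - g x"] smooth_minus[of g] by simp

lemma smooth_inner:
  fixes f g :: "'a::euclidean_space \<Rightarrow> 'b::euclidean_space"
  assumes "smooth f" "smooth g"
  shows "smooth (\<lambda>x. f x \<bullet> g x)"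
  by (subst euclidean_inner, intro smooth_sum smooth_mult_real smooth_bounded_linear_comp[OF bounded_linear_inner_left] assms)

lemma smooth_Pair:
  assumes "smooth f" "smooth g"
  shows "smooth (\<lambda>x. (f x, g x))"
proof -
  have "smooth (\<lambda>x. (f x, 0))" "smooth (\<lambda>x. (0, g x))"
    using assms
    by (auto intro!: smooth_bounded_linear_comp[where L="\<lambda>y. (y, 0)"]
        smooth_bounded_linear_comp[where L="\<lambda>y. (0, y)"]
        bounded_linear_Pair bounded_linear_ident bounded_linear_zero)
  from smooth_add[OF this] show ?thesis by simp
qed

lemma linear_euclidean_expansion:
  fixes L :: "'a::euclidean_space \<Rightarrow> 'b::real_vector"
  assumes "linear L"
  shows "L v = (\<Sum>b\<in>Basis. (v \<bullet> b) *\<^sub>R L b)"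
proof -
  have "L v = L (\<Sum>b\<in>Basis. (v \<bullet> b) *\<^sub>R b)" by (simp add: euclidean_representation)
  then show ?thesis by (simp add: linear_sum[OF assms] linear_scale[OF assms])
qed

lemma C_k_compose:
  fixes f :: "'b::euclidean_space \<Rightarrow> 'c::real_normed_vector" and g :: "'a::euclidean_space \<Rightarrow> 'b"
  shows "C_k k f \<Longrightarrow> C_k k g \<Longrightarrow> C_k k (\<lambda>x. f (g x))"
proof (induction k arbitrary: f)
  case 0
  then show ?case using continuous_on_compose2[of UNIV f UNIV g] by simp
next
  case (Suc k)
  from Suc.prems obtain f' g' where d:
    "\<And>x. (f has_derivative f' x) (at x)" "\<And>v. C_k k (\<lambda>x. f' x v)"
    "\<And>x. (g has_derivative g' x) (at x)" "\<And>v. C_k k (\<lambda>x. g' x v)"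
    by auto
  have g: "C_k k g" using Suc.prems(2) by (rule C_k_Suc_imp)
  have "((\<lambda>x. f (g x)) has_derivative (\<lambda>v. f' (g x) (g' x v))) (at x)" for x
    by (rule has_derivative_compose[OF d(3) d(1)])
  moreover have "C_k k (\<lambda>x. f' (g x) (g' x v))" for v
  proof -
    \<comment> \<open>\<open>C_k\<close> controls \<open>f'\<close> only in fixed directions, so the
      moving direction \<open>g' x v\<close> is expanded in the basis.\<close>
    have "(\<lambda>x. f' (g x) (g' x v)) = (\<lambda>x. \<Sum>b\<in>Basis. (g' x v \<bullet> b) *\<^sub>R f' (g x) b)"
      using linear_euclidean_expansion[OF has_derivative_linear[OF d(1)]] by blast
    moreover have "C_k k (\<lambda>x. \<Sum>b\<in>Basis. (g' x v \<bullet> b) *\<^sub>R f' (g x) b)"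
      by (intro C_k_sum C_k_scaleR C_k_bounded_linear_comp[OF bounded_linear_inner_left] d(4)
          Suc.IH d(2) g)
    ultimately show ?thesis by simp
  qed
  ultimately show ?case
    unfolding C_k.simps by (intro exI[of _ "\<lambda>x v. f' (g x) (g' x v)"]) simp
qed

lemma smooth_compose:
  fixes f :: "'b::euclidean_space \<Rightarrow> 'c::real_normed_vector" and g :: "'a::euclidean_space \<Rightarrow> 'b"
  shows "smooth f \<Longrightarrow> smooth g \<Longrightarrow> smooth (\<lambda>x. f (g x))"
  by (simp add: smooth_def C_k_compose)

lemma smooth_directional_derivative:
  fixes f :: "'b::euclidean_space \<Rightarrow> 'c::real_normed_vector" and g V :: "'a::euclidean_space \<Rightarrow> 'b"
  assumes "smooth f" "smooth g" "smooth V"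
  shows "smooth (\<lambda>x. frechet_derivative f (at (g x)) (V x))"
proof -
  have "(\<lambda>x. frechet_derivative f (at (g x)) (V x)) =
      (\<lambda>x. \<Sum>b\<in>Basis. (V x \<bullet> b) *\<^sub>R frechet_derivative f (at (g x)) b)"
    using linear_euclidean_expansion[OF smooth_linear_derivative[OF assms(1)]] by blast
  moreover have "smooth (\<lambda>x. \<Sum>b\<in>Basis. (V x \<bullet> b) *\<^sub>R frechet_derivative f (at (g x)) b)"
    by (intro smooth_sum smooth_scaleR smooth_bounded_linear_comp[OF bounded_linear_inner_left]
        smooth_compose[OF smooth_frechet_derivative] assms)
  ultimately show ?thesis by simp
qed

lemma smooth_lie_bracket: "smooth V \<Longrightarrow> smooth W \<Longrightarrow> smooth (lie_bracket V W)"
  unfolding lie_bracket_def by (intro smooth_diff smooth_directional_derivative smooth_ident)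

section \<open>Symmetry of second derivatives\<close>

lemma smooth_second_difference:
  fixes f :: "'a::euclidean_space \<Rightarrow> real"
  assumes f: "smooth f" and r: "0 < r"
  shows "\<exists>a b. 0 \<le> a \<and> a \<le> r \<and> 0 \<le> b \<and> b \<le> r \<and>
    f (x + r *\<^sub>R v + r *\<^sub>R w) - f (x + r *\<^sub>R v) - f (x + r *\<^sub>R w) + f x =
    r\<^sup>2 * frechet_derivative (\<lambda>y. frechet_derivative f (at y) v) (at (x + a *\<^sub>R v + b *\<^sub>R w)) w"
proof -
  have line: "((\<lambda>s. g (y + s *\<^sub>R u)) has_real_derivative frechet_derivative g (at (y + s *\<^sub>R u)) u) (at s)"
    if "smooth g" for g :: "'a \<Rightarrow> real" and y u s
  proof -
    have "((\<lambda>s. y + s *\<^sub>R u) has_derivative (\<lambda>t. t *\<^sub>R u)) (at s)"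
      by (auto intro!: derivative_eq_intros)
    from has_derivative_compose[OF this smooth_has_derivative[OF that]]
    show ?thesis
      by (simp add: has_field_derivative_def linear_scale[OF smooth_linear_derivative[OF that]]
          mult.commute[of _ "frechet_derivative g (at (y + s *\<^sub>R u)) u"])
  qed
  let ?D = "\<lambda>y. frechet_derivative f (at y) v"
  \<comment> \<open>The mean value theorem is used twice: here in direction \<open>v\<close>, on the
    increment of \<open>f\<close> under the shift by \<open>r *\<^sub>R w\<close>, and then in
    direction \<open>w\<close>, on the derivative \<open>?D\<close>.\<close>
  have "\<exists>a. 0 < a \<and> a < r \<and>
    (f (x + r *\<^sub>R w + r *\<^sub>R v) - f (x + r *\<^sub>R v)) - (f (x + r *\<^sub>R w + 0 *\<^sub>R v) - f (x + 0 *\<^sub>R v)) =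
    (r - 0) * (?D (x + r *\<^sub>R w + a *\<^sub>R v) - ?D (x + a *\<^sub>R v))"
    by (rule MVT2[OF r]) (intro DERIV_diff line f)
  then obtain a where a: "0 < a" "a < r"
    "f (x + r *\<^sub>R w + r *\<^sub>R v) - f (x + r *\<^sub>R v) - (f (x + r *\<^sub>R w) - f x) =
    r * (?D (x + r *\<^sub>R w + a *\<^sub>R v) - ?D (x + a *\<^sub>R v))"
    by auto
  have "\<exists>b. 0 < b \<and> b < r \<and>
    ?D (x + a *\<^sub>R v + r *\<^sub>R w) - ?D (x + a *\<^sub>R v + 0 *\<^sub>R w) =
    (r - 0) * frechet_derivative ?D (at (x + a *\<^sub>R v + b *\<^sub>R w)) w"
    by (rule MVT2[OF r]) (intro line smooth_frechet_derivative f)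
  then obtain b where b: "0 < b" "b < r"
    "?D (x + a *\<^sub>R v + r *\<^sub>R w) - ?D (x + a *\<^sub>R v) =
    r * frechet_derivative ?D (at (x + a *\<^sub>R v + b *\<^sub>R w)) w"
    by auto
  have "f (x + r *\<^sub>R v + r *\<^sub>R w) - f (x + r *\<^sub>R v) - f (x + r *\<^sub>R w) + f x =
    r\<^sup>2 * frechet_derivative ?D (at (x + a *\<^sub>R v + b *\<^sub>R w)) w"
    using a(3) b(3) by (simp add: algebra_simps power2_eq_square)
  then show ?thesis using a b by (intro exI[of _ a] exI[of _ b]) auto
qed

text \<open>The second difference quotient \<open>D v w\<close> is symmetric in \<open>v\<close> and
  \<open>w\<close>, and by continuity it tends to the iterated derivative taken in either
  order.\<close>

lemma smooth_derivative_commute_real: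
  fixes f :: "'a::euclidean_space \<Rightarrow> real"
  assumes f: "smooth f"
  shows "frechet_derivative (\<lambda>y. frechet_derivative f (at y) v) (at x) w =
    frechet_derivative (\<lambda>y. frechet_derivative f (at y) w) (at x) v"
proof -
  define A where "A v w y = frechet_derivative (\<lambda>y. frechet_derivative f (at y) v) (at y) w" for v w y
  define r where "r n = inverse (real (Suc n))" for n
  have r: "r n > 0" for n by (simp add: r_def)
  have r0: "r \<longlonglongrightarrow> 0"
    unfolding r_def by (rule LIMSEQ_inverse_real_of_nat)
  define D where "D v w n = (f (x + r n *\<^sub>R v + r n *\<^sub>R w) - f (x + r n *\<^sub>R v) - f (x + r n *\<^sub>R w) + f x) / (r n)\<^sup>2"
    for v w n
  have lim: "D v w \<longlonglongrightarrow> A v w x" for v w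
  proof -
    have "\<forall>n. \<exists>a b. 0 \<le> a \<and> a \<le> r n \<and> 0 \<le> b \<and> b \<le> r n \<and> D v w n = A v w (x + a *\<^sub>R v + b *\<^sub>R w)"
    proof
      fix n
      obtain a b where ab: "0 \<le> a" "a \<le> r n" "0 \<le> b" "b \<le> r n"
        "f (x + r n *\<^sub>R v + r n *\<^sub>R w) - f (x + r n *\<^sub>R v) - f (x + r n *\<^sub>R w) + f x =
          (r n)\<^sup>2 * A v w (x + a *\<^sub>R v + b *\<^sub>R w)"
        unfolding A_def using smooth_second_difference[OF f r] by blast
      show "\<exists>a b. 0 \<le> a \<and> a \<le> r n \<and> 0 \<le> b \<and> b \<le> r n \<and> D v w n = A v w (x + a *\<^sub>R v + b *\<^sub>R w)"
        by (rule exI[of _ a], rule exI[of _ b], simp only: D_def ab(5))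
          (use ab r[of n] in simp)
    qed
    then obtain a b where ab: "\<And>n. 0 \<le> a n \<and> a n \<le> r n \<and> 0 \<le> b n \<and> b n \<le> r n \<and>
        D v w n = A v w (x + a n *\<^sub>R v + b n *\<^sub>R w)" by metis
    have "a \<longlonglongrightarrow> 0" "b \<longlonglongrightarrow> 0"
      by (rule tendsto_sandwich[OF _ _ tendsto_const r0]; use ab in simp)+
    then have "(\<lambda>n. x + a n *\<^sub>R v + b n *\<^sub>R w) \<longlonglongrightarrow> x + 0 *\<^sub>R v + 0 *\<^sub>R w"
      by (intro tendsto_intros)
    then have "(\<lambda>n. x + a n *\<^sub>R v + b n *\<^sub>R w) \<longlonglongrightarrow> x" by simp
    moreover have "isCont (A v w) x"
      unfolding A_def
      using smooth_continuous_on[OF smooth_frechet_derivative[OF smooth_frechet_derivative[OF f]], of UNIV]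
      by (simp add: continuous_on_eq_continuous_at)
    ultimately have "(\<lambda>n. A v w (x + a n *\<^sub>R v + b n *\<^sub>R w)) \<longlonglongrightarrow> A v w x"
      by (rule isCont_tendsto_compose[rotated])
    moreover have "D v w = (\<lambda>n. A v w (x + a n *\<^sub>R v + b n *\<^sub>R w))"
      using ab by blast
    ultimately show ?thesis by simp
  qed
  have "D v w = D w v" by (simp add: D_def fun_eq_iff algebra_simps)
  with lim[of v w] lim[of w v] show ?thesis
    unfolding A_def by (metis LIMSEQ_unique)
qed

lemma frechet_derivative_inner_left:
  assumes "smooth f"
  shows "frechet_derivative (\<lambda>y. f y \<bullet> c) (at x) v = frechet_derivative f (at x) v \<bullet> c"
proof -
  have "((\<lambda>y. f y \<bullet> c) has_derivative (\<lambda>v. frechet_derivative f (at x) v \<bullet> c)) (at x)"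
    by (rule has_derivative_inner_left[OF smooth_has_derivative[OF assms]])
  from frechet_derivative_at[OF this] show ?thesis by metis
qed

lemma smooth_derivative_commute:
  fixes f :: "'a::euclidean_space \<Rightarrow> 'b::euclidean_space"
  assumes f: "smooth f"
  shows "frechet_derivative (\<lambda>y. frechet_derivative f (at y) v) (at x) w =
    frechet_derivative (\<lambda>y. frechet_derivative f (at y) w) (at x) v"
proof -
  have "smooth (\<lambda>y. f y \<bullet> c)" for c
    using f by (rule smooth_bounded_linear_comp[OF bounded_linear_inner_left])
  from smooth_derivative_commute_real[OF this] show ?thesis
    by (simp add: frechet_derivative_inner_left f smooth_frechet_derivative euclidean_eq_iff[where 'a='b])
qed

section \<open>Invariant fields and coframes\<close>

lemma spanning_five_independent:
  fixes B :: "nat \<Rightarrow> real^5"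
  assumes "span (B ` {1..5}) = UNIV"
  shows "independent (B ` {1..5})" and "inj_on B {1..5}"
proof -
  have "card (B ` {1..5}) \<le> card {1..5::nat}"
    by (rule card_image_le) simp
  moreover have "dim (UNIV :: (real^5) set) \<le> card (B ` {1..5})"
    by (rule dim_le_card) (use assms in auto)
  moreover have "dim (UNIV :: (real^5) set) = 5" by simp
  ultimately have c: "card (B ` {1..5}) = 5" by simp
  then show "inj_on B {1..5}" by (intro eq_card_imp_inj_on) auto
  show "independent (B ` {1..5})"
    by (rule card_le_dim_spanning[of _ UNIV]) (use assms c in auto)
qed

lemma dual_basis_exists:
  fixes B :: "nat \<Rightarrow> real^5"
  assumes "span (B ` {1..5}) = UNIV"
  shows "\<exists>d :: nat \<Rightarrow> real^5. \<forall>j\<in>{1..5}. \<forall>k\<in>{1..5}. d j \<bullet> B k = (if j = k then 1 else 0)"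
proof -
  have "\<exists>d. \<forall>k\<in>{1..5}. d \<bullet> B k = (if j = k then 1 else 0)" if j: "j \<in> {1..5}" for j
  proof -
    obtain f :: "real^5 \<Rightarrow> real" where f: "linear f" "\<forall>v\<in>B ` {1..5}. f v = (if v = B j then 1 else 0)"
      using linear_independent_extend[OF spanning_five_independent(1)[OF assms],
          of "\<lambda>v. if v = B j then 1 else 0"] by blast
    \<comment> \<open>Covectors act by the inner product, so the functional \<open>f\<close> is
      represented by the vector \<open>adjoint f 1\<close>.\<close>
    have "adjoint f 1 \<bullet> v = f v" for v
      using adjoint_works[OF f(1), of v 1] by (simp add: inner_commute)
    moreover have "f (B k) = (if j = k then 1 else 0)" if "k \<in> {1..5}" for k
      using f(2) that j inj_onD[OF spanning_five_independent(2)[OF assms]] by auto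
    ultimately show ?thesis by metis
  qed
  then show ?thesis by metis
qed

lemma frechet_derivative_partial:
  assumes "smooth F"
  shows "((\<lambda>x. F (x, y)) has_derivative (\<lambda>v. frechet_derivative F (at (x, y)) (v, 0))) (at x)"
    and "((\<lambda>y. F (x, y)) has_derivative (\<lambda>v. frechet_derivative F (at (x, y)) (0, v))) (at y)"
proof -
  have "((\<lambda>x. (x, y)) has_derivative (\<lambda>v. (v, 0))) (at x)"
    "((\<lambda>y. (x, y)) has_derivative (\<lambda>v. (0, v))) (at y)"
    by (auto intro!: derivative_eq_intros)
  note this[THEN has_derivative_compose, OF smooth_has_derivative[OF assms]]
  then show "((\<lambda>x. F (x, y)) has_derivative (\<lambda>v. frechet_derivative F (at (x, y)) (v, 0))) (at x)"
    and "((\<lambda>y. F (x, y)) has_derivative (\<lambda>v. frechet_derivative F (at (x, y)) (0, v))) (at y)"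
    by simp_all
qed

text \<open>Keeps the index in \<open>X 1\<close>, \<open>coframe 1\<close> or \<open>h X 1\<close>
  from being rewritten to \<open>Suc 0\<close>, which would stop facts about these terms from
  matching.\<close>

declare One_nat_def [simp del]

section \<open>Differential of the product and right-invariant fields\<close>

context cartan_group
begin

text \<open>The joint differential is kept instead of those of the two translations: both are its
  restrictions to \<open>(v, 0)\<close> and \<open>(0, v)\<close>, and mixed second derivatives
  become available.\<close>

definition mult_deriv :: "(real^5) \<times> (real^5) \<Rightarrow> (real^5) \<times> (real^5) \<Rightarrow> real^5" where
  "mult_deriv z = frechet_derivative (\<lambda>(x, y). gmul x y) (at z)"

lemma linear_mult_deriv: "linear (mult_deriv z)"
  unfolding mult_deriv_def by (rule smooth_linear_derivative[OF smooth_mult])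

lemma smooth_mult_deriv: "smooth (\<lambda>z. mult_deriv z v)"
  unfolding mult_deriv_def by (rule smooth_frechet_derivative[OF smooth_mult])

lemma mult_has_derivative_left:
  "((\<lambda>g. gmul g x) has_derivative (\<lambda>v. mult_deriv (g, x) (v, 0))) (at g)"
  using frechet_derivative_partial(1)[OF smooth_mult] by (simp add: mult_deriv_def)

lemma mult_has_derivative_right:
  "(gmul g has_derivative (\<lambda>v. mult_deriv (g, x) (0, v))) (at x)"
  using frechet_derivative_partial(2)[OF smooth_mult] by (simp add: mult_deriv_def)

lemma left_translation_X:
  assumes "i \<in> {1..5}"
  shows "mult_deriv (g, x) (0, X i x) = X i (gmul g x)"
  using left_invariant_X[OF assms]
  by (simp add: left_invariant_def frechet_derivative_at[OF mult_has_derivative_right, symmetric])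

text \<open>The right-invariant field with value \<open>y\<close> at the identity: the differential
  at \<open>e\<close> of right translation by \<open>x\<close>, applied to \<open>y\<close>.\<close>

definition right_field :: "real^5 \<Rightarrow> vfield" where
  "right_field y x = mult_deriv (e, x) (y, 0)"

lemma smooth_right_field: "smooth (right_field y)"
  unfolding right_field_def
  by (rule smooth_compose[OF smooth_mult_deriv])
    (intro smooth_Pair smooth_const smooth_ident)

text \<open>
  Differentiating the left invariance of \<open>X i\<close> in the translation parameter gives the mixed second
  derivative of the product, whose symmetry is the commutation of \<open>X i\<close> with right-invariant fields.
\<close>

lemma right_field_commutes:
  assumes i: "i \<in> {1..5}"
  shows "lie_bracket (X i) (right_field y) x = 0"
proof -
  let ?w = "X i x"
  have "((\<lambda>x. mult_deriv (e, x) (y, 0)) has_derivative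
      (\<lambda>v. frechet_derivative (\<lambda>z. mult_deriv z (y, 0)) (at (e, x)) (0, v))) (at x)"
    by (rule frechet_derivative_partial(2)[OF smooth_mult_deriv])
  then have R: "frechet_derivative (right_field y) (at x) ?w =
      frechet_derivative (\<lambda>z. mult_deriv z (y, 0)) (at (e, x)) (0, ?w)"
    unfolding right_field_def[abs_def] by (metis frechet_derivative_at)
  have "((\<lambda>g. X i (gmul g x)) has_derivative
      (\<lambda>v. frechet_derivative (\<lambda>z. mult_deriv z (0, ?w)) (at (e, x)) (v, 0))) (at e)"
    using frechet_derivative_partial(1)[OF smooth_mult_deriv, of x "(0, ?w)" e]
    by (simp add: left_translation_X[OF i])
  moreover have "((\<lambda>g. X i (gmul g x)) has_derivative
      (\<lambda>v. frechet_derivative (X i) (at (gmul e x)) (mult_deriv (e, x) (v, 0)))) (at e)"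
    by (rule has_derivative_compose[OF mult_has_derivative_left smooth_has_derivative[OF smooth_X[OF i]]])
  ultimately have "frechet_derivative (\<lambda>z. mult_deriv z (0, ?w)) (at (e, x)) (y, 0) =
      frechet_derivative (X i) (at x) (right_field y x)"
    using has_derivative_unique by (fastforce simp: right_field_def group_left_neutral dest: fun_cong)
  moreover have "frechet_derivative (\<lambda>z. mult_deriv z (0, ?w)) (at (e, x)) (y, 0) =
      frechet_derivative (\<lambda>z. mult_deriv z (y, 0)) (at (e, x)) (0, ?w)"
    unfolding mult_deriv_def by (rule smooth_derivative_commute[OF smooth_mult])
  ultimately show ?thesis by (simp add: lie_bracket_def R)
qed

text \<open>Right translation by \<open>ginv x\<close> followed by right translation by
  \<open>x\<close> is the identity; differentiate at \<open>x\<close>. So right-invariant fields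
  attain every tangent vector at every point.\<close>

lemma right_field_surj: "right_field (mult_deriv (x, ginv x) (v, 0)) x = v"
proof -
  have "((\<lambda>g. gmul (gmul g (ginv x)) x) has_derivative
      (\<lambda>v. mult_deriv (gmul x (ginv x), x) (mult_deriv (x, ginv x) (v, 0), 0))) (at x)"
    by (rule has_derivative_compose[OF mult_has_derivative_left mult_has_derivative_left])
  moreover have "gmul (gmul g (ginv x)) x = g" for g
    by (simp add: assoc)
  moreover have "gmul x (ginv x) = e" by simp
  ultimately have "((\<lambda>g. g) has_derivative
      (\<lambda>v. right_field (mult_deriv (x, ginv x) (v, 0)) x)) (at x)"
    by (simp add: right_field_def)
  then have "(\<lambda>v. right_field (mult_deriv (x, ginv x) (v, 0)) x) = (\<lambda>v. v)"
    by (rule has_derivative_unique) (rule has_derivative_ident)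
  then show ?thesis by (rule fun_cong)
qed

section \<open>The left-invariant coframe\<close>

lemma frame_image: "span ((\<lambda>k. X k x) ` {1..5}) = UNIV"
proof -
  have "{1..5::nat} = {1, 2, 3, 4, 5}" by auto
  then show ?thesis using frame_X by simp
qed

text \<open>A dual basis at \<open>e\<close> is pulled back by the left translation that takes
  \<open>x\<close> to \<open>e\<close>. Left invariance of the \<open>X k\<close> keeps it dual
  everywhere.\<close>

lemma coframe_exists:
  "\<exists>\<theta>. (\<forall>k. smooth (\<theta> k)) \<and>
    (\<forall>j\<in>{1..5}. \<forall>k\<in>{1..5}. \<forall>x. \<theta> j x \<bullet> X k x = (if j = k then 1 else 0 :: real))"
proof -
  obtain d where d: "\<And>j k. j \<in> {1..5} \<Longrightarrow> k \<in> {1..5} \<Longrightarrow> d j \<bullet> X k e = (if j = k then 1 else 0 :: real)"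
    using dual_basis_exists[OF frame_image] by metis
  \<comment> \<open>The sum is the vector representing the functional that sends \<open>v\<close> to
    \<open>d j \<bullet> mult_deriv (ginv x, x) (0, v)\<close>.\<close>
  define \<theta> where "\<theta> j x = (\<Sum>b\<in>Basis. (d j \<bullet> mult_deriv (ginv x, x) (0, b)) *\<^sub>R b)" for j x
  have "smooth (\<lambda>x. mult_deriv (ginv x, x) (0, b))" for b
    by (rule smooth_compose[OF smooth_mult_deriv])
      (intro smooth_Pair smooth_inv smooth_ident)
  then have "smooth (\<theta> j)" for j
    unfolding \<theta>_def by (intro smooth_sum smooth_scaleR smooth_inner smooth_const)
  moreover have "\<theta> j x \<bullet> v = d j \<bullet> mult_deriv (ginv x, x) (0, v)" for j x v
  proof -
    have "linear (\<lambda>v. d j \<bullet> mult_deriv (ginv x, x) (0, v))"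
      by (intro linearI)
        (simp_all flip: inner_add_right inner_scaleR_right linear_add[OF linear_mult_deriv]
          linear_scale[OF linear_mult_deriv])
    from linear_euclidean_expansion[OF this, of v] show ?thesis
      by (simp add: \<theta>_def inner_sum_left inner_commute[of v] mult.commute)
  qed
  then have "\<theta> j x \<bullet> X k x = (if j = k then 1 else 0)" if "j \<in> {1..5}" "k \<in> {1..5}" for j k x
    using that d by (simp add: left_translation_X)
  ultimately show ?thesis by blast
qed

definition coframe :: "nat \<Rightarrow> vfield" where
  "coframe = (SOME \<theta>. (\<forall>k. smooth (\<theta> k)) \<and>
    (\<forall>j\<in>{1..5}. \<forall>k\<in>{1..5}. \<forall>x. \<theta> j x \<bullet> X k x = (if j = k then 1 else 0)))"

lemma smooth_coframe: "smooth (coframe k)"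
  and coframe_X: "j \<in> {1..5} \<Longrightarrow> k \<in> {1..5} \<Longrightarrow> coframe j x \<bullet> X k x = (if j = k then 1 else 0)"
  using someI_ex[OF coframe_exists, folded coframe_def] by blast+

lemma coframe_X_simps [simp]:
  "coframe 1 x \<bullet> X 1 x = 1" "coframe 1 x \<bullet> X 2 x = 0" "coframe 1 x \<bullet> X 3 x = 0" "coframe 1 x \<bullet> X 4 x = 0" "coframe 1 x \<bullet> X 5 x = 0"
  "coframe 2 x \<bullet> X 1 x = 0" "coframe 2 x \<bullet> X 2 x = 1" "coframe 2 x \<bullet> X 3 x = 0" "coframe 2 x \<bullet> X 4 x = 0" "coframe 2 x \<bullet> X 5 x = 0"
  "coframe 3 x \<bullet> X 1 x = 0" "coframe 3 x \<bullet> X 2 x = 0" "coframe 3 x \<bullet> X 3 x = 1" "coframe 3 x \<bullet> X 4 x = 0" "coframe 3 x \<bullet> X 5 x = 0"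
  "coframe 4 x \<bullet> X 1 x = 0" "coframe 4 x \<bullet> X 2 x = 0" "coframe 4 x \<bullet> X 3 x = 0" "coframe 4 x \<bullet> X 4 x = 1" "coframe 4 x \<bullet> X 5 x = 0"
  "coframe 5 x \<bullet> X 1 x = 0" "coframe 5 x \<bullet> X 2 x = 0" "coframe 5 x \<bullet> X 3 x = 0" "coframe 5 x \<bullet> X 4 x = 0" "coframe 5 x \<bullet> X 5 x = 1"
  by (subst coframe_X; simp)+

lemma frame_expansion:
  "v = (coframe 1 x \<bullet> v) *\<^sub>R X 1 x + (coframe 2 x \<bullet> v) *\<^sub>R X 2 x + (coframe 3 x \<bullet> v) *\<^sub>R X 3 x
     + (coframe 4 x \<bullet> v) *\<^sub>R X 4 x + (coframe 5 x \<bullet> v) *\<^sub>R X 5 x" (is "v = ?E v")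
proof -
  have "v \<in> span {X 1 x, X 2 x, X 3 x, X 4 x, X 5 x}" by (simp only: frame_X UNIV_I)
  then show ?thesis
  proof (induction rule: span_induct_alt)
    case (step c b y)
    have "b = ?E b" using step(1) by auto
    moreover have "?E (c *\<^sub>R b + y) = c *\<^sub>R ?E b + ?E y"
      by (simp add: algebra_simps inner_add_right)
    ultimately show ?case using step(2) by metis
  qed simp
qed

lemma horizontal_expansion:
  assumes "v \<in> span {X 1 x, X 2 x}"
  shows "v = (coframe 1 x \<bullet> v) *\<^sub>R X 1 x + (coframe 2 x \<bullet> v) *\<^sub>R X 2 x"
    and "coframe 3 x \<bullet> v = 0" "coframe 4 x \<bullet> v = 0" "coframe 5 x \<bullet> v = 0"
proof -
  obtain a b where v: "v = a *\<^sub>R X 1 x + b *\<^sub>R X 2 x"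
    using assms by (auto simp: span_insert span_singleton algebra_simps)
  then show "v = (coframe 1 x \<bullet> v) *\<^sub>R X 1 x + (coframe 2 x \<bullet> v) *\<^sub>R X 2 x"
    and "coframe 3 x \<bullet> v = 0" "coframe 4 x \<bullet> v = 0" "coframe 5 x \<bullet> v = 0"
    by (simp_all add: inner_add_right)
qed

end

section \<open>Normal extremals\<close>

text \<open>The adjoint brings the differential of the momentum of \<open>Y\<close> into the form
  that \<open>hamiltonian_field_eq\<close> requires.\<close>

lemma pairing_has_derivative:
  fixes Y :: vfield
  assumes "smooth Y"
  shows "((\<lambda>z. snd z \<bullet> Y (fst z)) has_derivative
    (\<lambda>v. fst v \<bullet> adjoint (frechet_derivative Y (at (fst z))) (snd z) + snd v \<bullet> Y (fst z))) (at z)"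
proof -
  have "((\<lambda>z. Y (fst z)) has_derivative (\<lambda>v. frechet_derivative Y (at (fst z)) (fst v))) (at z)"
    by (rule has_derivative_compose[OF has_derivative_fst[OF has_derivative_ident]
          smooth_has_derivative[OF assms]])
  from has_derivative_inner[OF has_derivative_snd[OF has_derivative_ident] this]
  show ?thesis
    by (simp add: adjoint_works[OF smooth_linear_derivative[OF assms]] inner_commute)
qed

lemma h_eq: "h X i = (\<lambda>z. snd z \<bullet> X i (fst z))"
  by (simp add: h_def fun_eq_iff)

lemma hamiltonian_field_h:
  assumes "smooth (X i)"
  shows "hamiltonian_field (h X i) z = (X i (fst z), - adjoint (frechet_derivative (X i) (at (fst z))) (snd z))"
  unfolding h_eq by (rule hamiltonian_field_eq[OF pairing_has_derivative[OF assms]])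

lemma hamiltonian_field_hamiltonian:
  assumes "smooth (X 1)" "smooth (X 2)"
  shows "hamiltonian_field (hamiltonian X) z =
    h X 1 z *\<^sub>R hamiltonian_field (h X 1) z + h X 2 z *\<^sub>R hamiltonian_field (h X 2) z"
proof -
  let ?a = "\<lambda>i. adjoint (frechet_derivative (X i) (at (fst z))) (snd z)"
  have d: "(h X i has_derivative (\<lambda>v. fst v \<bullet> ?a i + snd v \<bullet> X i (fst z))) (at z)"
    if "smooth (X i)" for i
    unfolding h_eq by (rule pairing_has_derivative[OF that])
  have "((\<lambda>z. ((h X 1 z)\<^sup>2 + (h X 2 z)\<^sup>2) / 2) has_derivative
    (\<lambda>v. fst v \<bullet> (h X 1 z *\<^sub>R ?a 1 + h X 2 z *\<^sub>R ?a 2) +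
      snd v \<bullet> (h X 1 z *\<^sub>R X 1 (fst z) + h X 2 z *\<^sub>R X 2 (fst z)))) (at z)"
    by (rule has_derivative_eq_rhs, (rule derivative_intros d assms)+)
      (auto simp: fun_eq_iff inner_add_right field_simps)
  then have "(hamiltonian X has_derivative
    (\<lambda>v. fst v \<bullet> (h X 1 z *\<^sub>R ?a 1 + h X 2 z *\<^sub>R ?a 2) +
      snd v \<bullet> (h X 1 z *\<^sub>R X 1 (fst z) + h X 2 z *\<^sub>R X 2 (fst z)))) (at z)"
    by (simp add: hamiltonian_def[abs_def])
  from hamiltonian_field_eq[OF this] show ?thesis
    by (simp add: hamiltonian_field_h assms)
qed

lemma lie_bracket_swap: "lie_bracket W V x = - lie_bracket V W x"
  by (simp add: lie_bracket_def)

lemma lie_bracket_self: "lie_bracket V V x = 0"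
  by (simp add: lie_bracket_def)

text \<open>Derivatives at the end points are one-sided, so uniqueness rests on the interval being
  nondegenerate. This is what allows an identity on the interval to be differentiated in two ways
  and the results compared.\<close>

lemma real_derivative_unique_Icc:
  fixes f g :: "real \<Rightarrow> real"
  assumes "a < b" "t \<in> {a..b}"
    and "(f has_real_derivative d) (at t within {a..b})"
    and "(g has_real_derivative d') (at t within {a..b})"
    and "\<And>s. s \<in> {a..b} \<Longrightarrow> f s = g s"
  shows "d = d'"
proof -
  have "(g has_real_derivative d) (at t within {a..b})"
    using has_derivative_transform[of t "{a..b}" g f] assms(2,3,5)
    by (simp add: has_field_derivative_def)
  then show ?thesis
    using vector_derivative_unique_within_closed_interval[of a b t g d d'] assms
    by (simp add: has_real_derivative_iff_has_vector_derivative)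
qed

section \<open>The extremal and its momenta\<close>

locale normal_geodesic = cartan_group +
  fixes T :: real and l :: "real \<Rightarrow> cotangent"
  assumes T_pos: "0 < T"
    and extremal: "normal_extremal X T l"
    and speed: "unit_speed X T l"
begin

abbreviation "\<gamma> \<equiv> fst \<circ> l"

abbreviation "H i t \<equiv> h X i (l t)"

lemma smooth_X12: "smooth (X 1)" "smooth (X 2)"
  by (simp_all add: smooth_X)

lemma speed_eq: "t \<in> {0..T} \<Longrightarrow> (H 1 t)\<^sup>2 + (H 2 t)\<^sup>2 = 1"
  using speed by (simp add: unit_speed_def)

lemma l_deriv:
  assumes "t \<in> {0..T}"
  shows "(l has_vector_derivative H 1 t *\<^sub>R hamiltonian_field (h X 1) (l t)
    + H 2 t *\<^sub>R hamiltonian_field (h X 2) (l t)) (at t within {0..T})"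
  using extremal assms unfolding normal_extremal_def hamiltonian_field_hamiltonian[OF smooth_X12] by blast

lemma geodesic_deriv:
  assumes "t \<in> {0..T}"
  shows "(\<gamma> has_vector_derivative H 1 t *\<^sub>R X 1 (\<gamma> t) + H 2 t *\<^sub>R X 2 (\<gamma> t)) (at t within {0..T})"
  using bounded_linear.has_vector_derivative[OF bounded_linear_fst l_deriv[OF assms]]
  by (simp add: hamiltonian_field_h smooth_X12 o_def)

text \<open>This is the Poisson bracket of the Hamiltonian with the momentum of \<open>Y\<close>:
  the base component of the Hamiltonian field differentiates \<open>Y\<close>, the fibre component
  differentiates \<open>X 1\<close> and \<open>X 2\<close>, and together they form the Lie
  brackets.\<close>

lemma pairing_deriv:
  assumes Y: "smooth Y" and t: "t \<in> {0..T}"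
  shows "((\<lambda>t. snd (l t) \<bullet> Y (fst (l t))) has_real_derivative
    H 1 t * (snd (l t) \<bullet> lie_bracket (X 1) Y (fst (l t)))
    + H 2 t * (snd (l t) \<bullet> lie_bracket (X 2) Y (fst (l t)))) (at t within {0..T})"
proof -
  let ?x = "fst (l t)" and ?p = "snd (l t)"
  have "((\<lambda>t. snd (l t) \<bullet> Y (fst (l t))) has_derivative
    (\<lambda>s. s * (H 1 t * (?p \<bullet> lie_bracket (X 1) Y ?x) + H 2 t * (?p \<bullet> lie_bracket (X 2) Y ?x))))
    (at t within {0..T})"
    by (rule has_derivative_eq_rhs, rule has_derivative_compose
          [OF l_deriv[OF t, unfolded has_vector_derivative_def] pairing_has_derivative[OF Y]])
      (simp add: fun_eq_iff hamiltonian_field_h smooth_X12 lie_bracket_def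
        inner_add_left inner_add_right inner_diff_right
        adjoint_works[OF smooth_linear_derivative[OF Y]]
        inner_commute[of "adjoint _ _"]
        adjoint_works[OF smooth_linear_derivative[OF smooth_X12(1)]]
        adjoint_works[OF smooth_linear_derivative[OF smooth_X12(2)]]
        linear_add[OF smooth_linear_derivative[OF Y]] linear_scale[OF smooth_linear_derivative[OF Y]]
        inner_commute algebra_simps)
  then show ?thesis
    by (simp add: has_field_derivative_def mult.commute[of _ "_ + _"])
qed

lemma H_deriv:
  assumes "t \<in> {0..T}"
  shows "((\<lambda>t. H 1 t) has_real_derivative - H 2 t * H 3 t) (at t within {0..T})"
    and "((\<lambda>t. H 2 t) has_real_derivative H 1 t * H 3 t) (at t within {0..T})"
    and "((\<lambda>t. H 3 t) has_real_derivative H 1 t * H 4 t + H 2 t * H 5 t) (at t within {0..T})"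
    and "((\<lambda>t. H 4 t) has_real_derivative 0) (at t within {0..T})"
    and "((\<lambda>t. H 5 t) has_real_derivative 0) (at t within {0..T})"
proof -
  have i: "i \<in> {1..5}" if "i \<in> {1, 2, 3, 4, 5}" for i :: nat using that by auto
  have d: "((\<lambda>t. H i t) has_real_derivative
    H 1 t * (snd (l t) \<bullet> lie_bracket (X 1) (X i) (fst (l t)))
    + H 2 t * (snd (l t) \<bullet> lie_bracket (X 2) (X i) (fst (l t)))) (at t within {0..T})"
    if "i \<in> {1..5}" for i
    using pairing_deriv[OF smooth_X[OF that] assms] by (simp add: h_eq)
  note [simp] = lie_bracket_self bracket_12 bracket_13 bracket_14 bracket_15 bracket_23 bracket_24 bracket_25
    lie_bracket_swap[of "X 2" "X 1"]
  show "((\<lambda>t. H 1 t) has_real_derivative - H 2 t * H 3 t) (at t within {0..T})"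
    using d[of 1] by (simp add: h_eq)
  show "((\<lambda>t. H 2 t) has_real_derivative H 1 t * H 3 t) (at t within {0..T})"
    using d[of 2] by (simp add: h_eq)
  show "((\<lambda>t. H 3 t) has_real_derivative H 1 t * H 4 t + H 2 t * H 5 t) (at t within {0..T})"
    using d[of 3] by (simp add: h_eq)
  show "((\<lambda>t. H 4 t) has_real_derivative 0) (at t within {0..T})"
    using d[of 4] by simp
  show "((\<lambda>t. H 5 t) has_real_derivative 0) (at t within {0..T})"
    using d[of 5] by simp
qed

text \<open>Noether's theorem: right-invariant fields generate left translations, under which the
  Hamiltonian is invariant. Here it follows from \<open>right_field_commutes\<close>.\<close>

lemma right_field_momentum:
  assumes "t \<in> {0..T}"
  shows "snd (l t) \<bullet> right_field y (fst (l t)) = snd (l 0) \<bullet> right_field y (fst (l 0))"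
proof (rule has_field_derivative_zero_constant[of "{0..T}", THEN exE])
  show "convex {0..T}" by simp
  show "((\<lambda>t. snd (l t) \<bullet> right_field y (fst (l t))) has_real_derivative 0) (at s within {0..T})"
    if "s \<in> {0..T}" for s
    using pairing_deriv[OF smooth_right_field that] by (simp add: right_field_commutes)
next
  fix c assume "\<forall>s\<in>{0..T}. snd (l s) \<bullet> right_field y (fst (l s)) = c"
  then show ?thesis using assms T_pos by simp
qed

lemma extends_velocity_exists: "\<exists>V. extends_velocity X T \<gamma> V"
proof -
  \<comment> \<open>\<open>P v x\<close> is the vector at \<open>e\<close> whose right-invariant
    field passes through \<open>v\<close> at \<open>x\<close>. Pairing that field with the initial
    covector at the starting point gives, by conservation, the current momentum whenever
    \<open>x\<close> lies on the curve.\<close>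
  define P where "P v x = mult_deriv (x, ginv x) (v, 0)" for v x
  define a where "a i x = snd (l 0) \<bullet> right_field (P (X i x) x) (fst (l 0))" for i x
  have a: "smooth (a i)" if "i \<in> {1..5}" for i
    unfolding a_def P_def right_field_def mult_deriv_def
    by (intro smooth_inner smooth_directional_derivative smooth_Pair smooth_const smooth_mult smooth_inv
        smooth_ident smooth_X that)
  have aH: "a i (\<gamma> t) = H i t" if "t \<in> {0..T}" for i t
    using right_field_momentum[OF that, of "P (X i (fst (l t))) (fst (l t))"]
    by (simp add: a_def P_def right_field_surj h_def)
  let ?V = "\<lambda>x. a 1 x *\<^sub>R X 1 x + a 2 x *\<^sub>R X 2 x"
  have "horizontal X ?V"
    unfolding horizontal_def
    by (intro conjI allI smooth_add smooth_scaleR a smooth_X12 span_add span_scale span_base) simp_all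
  moreover have "?V (\<gamma> t) = vector_derivative \<gamma> (at t within {0..T})" if "t \<in> {0..T}" for t
    using vector_derivative_within_closed_interval[OF T_pos that geodesic_deriv[OF that]] aH[OF that]
    by simp
  ultimately show ?thesis unfolding extends_velocity_def by blast
qed

end

section \<open>Iterated brackets along the geodesic\<close>

context cartan_group
begin

text \<open>The exterior derivative of the one-form \<open>coframe k\<close>, evaluated on
  \<open>v\<close> and \<open>w\<close> extended to constant fields.\<close>

definition dcoframe :: "nat \<Rightarrow> real^5 \<Rightarrow> real^5 \<Rightarrow> real^5 \<Rightarrow> real" where
  "dcoframe k x v w = frechet_derivative (coframe k) (at x) v \<bullet> w - frechet_derivative (coframe k) (at x) w \<bullet> v"

lemma dcoframe_bilinear:
  "dcoframe k x (v + v') w = dcoframe k x v w + dcoframe k x v' w"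
  "dcoframe k x v (w + w') = dcoframe k x v w + dcoframe k x v w'"
  "dcoframe k x (a *\<^sub>R v) w = a * dcoframe k x v w"
  "dcoframe k x v (a *\<^sub>R w) = a * dcoframe k x v w"
  by (simp_all add: dcoframe_def inner_add_left inner_add_right algebra_simps
      linear_add[OF smooth_linear_derivative[OF smooth_coframe]]
      linear_scale[OF smooth_linear_derivative[OF smooth_coframe]])

lemma coframe_pairing_has_derivative:
  assumes "smooth Z"
  shows "((\<lambda>x. coframe k x \<bullet> Z x) has_derivative
    (\<lambda>v. coframe k x \<bullet> frechet_derivative Z (at x) v + frechet_derivative (coframe k) (at x) v \<bullet> Z x)) (at x)"
  by (rule has_derivative_inner[OF smooth_has_derivative[OF smooth_coframe] smooth_has_derivative[OF assms]])

lemma coframe_pairing_constant: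
  assumes "smooth Z" "\<And>x. coframe k x \<bullet> Z x = c"
  shows "coframe k x \<bullet> frechet_derivative Z (at x) v + frechet_derivative (coframe k) (at x) v \<bullet> Z x = 0"
  using has_derivative_unique[OF coframe_pairing_has_derivative[OF assms(1), of k x],
      unfolded assms(2), OF has_derivative_const] by (rule fun_cong)

text \<open>The Maurer-Cartan equation: since the pairings of coframe and frame are constant, the
  derivatives of the coframe can be traded for derivatives of the frame, which form the
  bracket.\<close>

lemma dcoframe_X:
  assumes "k \<in> {1..5}" "i \<in> {1..5}" "j \<in> {1..5}"
  shows "dcoframe k x (X i x) (X j x) = - (coframe k x \<bullet> lie_bracket (X i) (X j) x)"
  using coframe_pairing_constant[OF smooth_X[OF assms(3)] coframe_X[OF assms(1,3)], of x "X i x"]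
    coframe_pairing_constant[OF smooth_X[OF assms(2)] coframe_X[OF assms(1,2)], of x "X j x"]
  by (simp add: dcoframe_def lie_bracket_def inner_diff_right)

text \<open>With \<theta>k for \<open>coframe k\<close>, the brackets give d\<theta>3 = -\<theta>1
  \<and> \<theta>2, d\<theta>4 = -\<theta>1 \<and> \<theta>3, d\<theta>5 = -\<theta>2 \<and>
  \<theta>3, where \<and> is the wedge product. Terms containing \<theta>3(v) drop out for
  horizontal \<open>v\<close>.\<close>

lemma dcoframe_horizontal:
  assumes "v \<in> span {X 1 x, X 2 x}"
  shows "dcoframe 3 x v w = (coframe 2 x \<bullet> v) * (coframe 1 x \<bullet> w) - (coframe 1 x \<bullet> v) * (coframe 2 x \<bullet> w)"
    and "dcoframe 4 x v w = - (coframe 1 x \<bullet> v) * (coframe 3 x \<bullet> w)"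
    and "dcoframe 5 x v w = - (coframe 2 x \<bullet> v) * (coframe 3 x \<bullet> w)"
proof -
  have d: "dcoframe k x v w = (\<Sum>i\<in>{1, 2}. \<Sum>j\<in>{1, 2, 3, 4, 5}. (coframe i x \<bullet> v) * (coframe j x \<bullet> w) *
      - (coframe k x \<bullet> lie_bracket (X i) (X j) x))" if "k \<in> {1..5}" for k
  proof -
    have "dcoframe k x v w =
      dcoframe k x ((coframe 1 x \<bullet> v) *\<^sub>R X 1 x + (coframe 2 x \<bullet> v) *\<^sub>R X 2 x)
       ((coframe 1 x \<bullet> w) *\<^sub>R X 1 x + (coframe 2 x \<bullet> w) *\<^sub>R X 2 x + (coframe 3 x \<bullet> w) *\<^sub>R X 3 x
         + (coframe 4 x \<bullet> w) *\<^sub>R X 4 x + (coframe 5 x \<bullet> w) *\<^sub>R X 5 x)"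
      using horizontal_expansion(1)[OF assms] frame_expansion[of w x] by simp
    then show ?thesis
      using that by (simp add: dcoframe_bilinear dcoframe_X algebra_simps)
  qed
  note [simp] = lie_bracket_self bracket_12 bracket_13 bracket_14 bracket_15 bracket_23 bracket_24 bracket_25
    lie_bracket_swap[of "X 2" "X 1"]
  show "dcoframe 3 x v w = (coframe 2 x \<bullet> v) * (coframe 1 x \<bullet> w) - (coframe 1 x \<bullet> v) * (coframe 2 x \<bullet> w)"
    and "dcoframe 4 x v w = - (coframe 1 x \<bullet> v) * (coframe 3 x \<bullet> w)"
    and "dcoframe 5 x v w = - (coframe 2 x \<bullet> v) * (coframe 3 x \<bullet> w)"
    by (simp_all add: d)
qed

text \<open>Cartan's formula; the term \<open>Z (coframe k V)\<close> vanishes because \<open>V\<close> is horizontal.\<close>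

lemma derivative_coframe_horizontal:
  assumes V: "horizontal X V" and k: "k \<in> {3, 4, 5}"
  shows "coframe k x \<bullet> frechet_derivative Z (at x) (V x) + frechet_derivative (coframe k) (at x) (V x) \<bullet> Z x
      = coframe k x \<bullet> lie_bracket V Z x + dcoframe k x (V x) (Z x)"
proof -
  have "coframe k x \<bullet> V x = 0" for x
    using V k horizontal_expansion[of "V x" x] by (auto simp: horizontal_def)
  then have "coframe k x \<bullet> frechet_derivative V (at x) (Z x) + frechet_derivative (coframe k) (at x) (Z x) \<bullet> V x = 0"
    using V by (intro coframe_pairing_constant) (auto simp: horizontal_def)
  then show "coframe k x \<bullet> frechet_derivative Z (at x) (V x) + frechet_derivative (coframe k) (at x) (V x) \<bullet> Z x
      = coframe k x \<bullet> lie_bracket V Z x + dcoframe k x (V x) (Z x)"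
    by (simp add: lie_bracket_def dcoframe_def inner_diff_right)
qed

lemma horizontal_X: "horizontal X (X 1)" "horizontal X (X 2)"
  by (simp_all add: horizontal_def smooth_X span_base)

text \<open>The quarter turn of \<open>V\<close> in the orthonormal frame, which will serve as the
  field whose brackets with the velocity fill the flag.\<close>

lemma horizontal_rotation:
  assumes "horizontal X V"
  shows "horizontal X (\<lambda>x. - (coframe 2 x \<bullet> V x) *\<^sub>R X 1 x + (coframe 1 x \<bullet> V x) *\<^sub>R X 2 x)"
  using assms unfolding horizontal_def
  by (intro conjI allI smooth_add smooth_scaleR smooth_minus smooth_inner smooth_coframe smooth_X
      span_add span_scale span_base) simp_all

end

section \<open>Components of brackets with the velocity\<close>

context normal_geodesic
begin

text \<open>The very choice made in \<open>flag\<close>, so that the flag is generated by brackets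
  with \<open>V\<close>. All that is known of it is \<open>extends_velocity_V\<close>.\<close>

definition V :: vfield where
  "V = (SOME V. extends_velocity X T \<gamma> V)"

lemma extends_velocity_V: "extends_velocity X T \<gamma> V"
  unfolding V_def by (rule someI_ex[OF extends_velocity_exists])

lemma horizontal_V: "horizontal X V"
  and smooth_V: "smooth V"
  using extends_velocity_V by (simp_all add: extends_velocity_def horizontal_def)

lemma V_geodesic:
  assumes "t \<in> {0..T}"
  shows "V (\<gamma> t) = H 1 t *\<^sub>R X 1 (\<gamma> t) + H 2 t *\<^sub>R X 2 (\<gamma> t)"
  using extends_velocity_V vector_derivative_within_closed_interval[OF T_pos assms geodesic_deriv[OF assms]] assms
  by (simp add: extends_velocity_def)

lemma geodesic_has_derivative:
  assumes "t \<in> {0..T}"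
  shows "(\<gamma> has_derivative (\<lambda>s. s *\<^sub>R V (\<gamma> t))) (at t within {0..T})"
  using geodesic_deriv[OF assms] V_geodesic[OF assms] by (simp add: has_vector_derivative_def)

abbreviation coord :: "nat \<Rightarrow> vfield \<Rightarrow> real \<Rightarrow> real" where
  "coord k Z t \<equiv> coframe k (\<gamma> t) \<bullet> Z (\<gamma> t)"

lemma coord_V: "t \<in> {0..T} \<Longrightarrow> coord 1 V t = H 1 t" "t \<in> {0..T} \<Longrightarrow> coord 2 V t = H 2 t"
  using V_geodesic[of t] by (simp_all add: inner_add_right)

text \<open>Cartan's formula along the curve, with the structure equations inserted. Only the
  components modulo \<open>X 1\<close> and \<open>X 2\<close> appear: they are the ones that the
  values of \<open>V\<close> on the curve determine.\<close>

lemma coord_deriv: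
  assumes Z: "smooth Z" and t: "t \<in> {0..T}"
  shows "(coord 3 Z has_real_derivative
      coord 3 (lie_bracket V Z) t + (H 2 t * coord 1 Z t - H 1 t * coord 2 Z t)) (at t within {0..T})"
    and "(coord 4 Z has_real_derivative
      coord 4 (lie_bracket V Z) t - H 1 t * coord 3 Z t) (at t within {0..T})"
    and "(coord 5 Z has_real_derivative
      coord 5 (lie_bracket V Z) t - H 2 t * coord 3 Z t) (at t within {0..T})"
proof -
  let ?x = "fst (l t)"
  have d: "(coord k Z has_real_derivative
      coord k (lie_bracket V Z) t + dcoframe k (\<gamma> t) (V (\<gamma> t)) (Z (\<gamma> t))) (at t within {0..T})"
    if "k \<in> {3, 4, 5}" for k
  proof -
    have L: "linear (\<lambda>v. coframe k (\<gamma> t) \<bullet> frechet_derivative Z (at (\<gamma> t)) v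
        + frechet_derivative (coframe k) (at (\<gamma> t)) v \<bullet> Z (\<gamma> t))"
      by (rule has_derivative_linear[OF coframe_pairing_has_derivative[OF Z]])
    have "(coord k Z has_derivative (\<lambda>s. coframe k (\<gamma> t) \<bullet> frechet_derivative Z (at (\<gamma> t)) (s *\<^sub>R V (\<gamma> t))
        + frechet_derivative (coframe k) (at (\<gamma> t)) (s *\<^sub>R V (\<gamma> t)) \<bullet> Z (\<gamma> t))) (at t within {0..T})"
      by (rule has_derivative_compose[OF geodesic_has_derivative[OF t] coframe_pairing_has_derivative[OF Z]])
    then show ?thesis
      using derivative_coframe_horizontal[OF horizontal_V that, of "\<gamma> t"]
      unfolding has_field_derivative_def linear_scale[OF L] by (simp add: mult.commute[of _ "_ + _"])
  qed
  have "V (\<gamma> t) \<in> span {X 1 (\<gamma> t), X 2 (\<gamma> t)}"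
    using horizontal_V unfolding horizontal_def by blast
  note dc = dcoframe_horizontal[OF this, unfolded o_apply]
  show "(coord 3 Z has_real_derivative
      coord 3 (lie_bracket V Z) t + (H 2 t * coord 1 Z t - H 1 t * coord 2 Z t)) (at t within {0..T})"
    using d[of 3] coord_V[OF t] by (simp add: dc)
  show "(coord 4 Z has_real_derivative
      coord 4 (lie_bracket V Z) t - H 1 t * coord 3 Z t) (at t within {0..T})"
    using d[of 4] coord_V[OF t] by (simp add: dc)
  show "(coord 5 Z has_real_derivative
      coord 5 (lie_bracket V Z) t - H 2 t * coord 3 Z t) (at t within {0..T})"
    using d[of 5] coord_V[OF t] by (simp add: dc)
qed

text \<open>
  The components of \<open>Z\<close> along \<open>h 1 X 4 + h 2 X 5\<close> and \<open>- h 2 X 4 + h 1 X 5\<close>: a bracket with \<open>V\<close>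
  creates the first from \<open>X 3\<close>, and the second only through the rotation speed \<open>h 3\<close> of the velocity.
\<close>

definition tang :: "vfield \<Rightarrow> real \<Rightarrow> real" where
  "tang Z t = H 1 t * coord 4 Z t + H 2 t * coord 5 Z t"

definition perp :: "vfield \<Rightarrow> real \<Rightarrow> real" where
  "perp Z t = H 1 t * coord 5 Z t - H 2 t * coord 4 Z t"

text \<open>The \<open>coord 3\<close> terms of \<open>coord_deriv\<close> cancel, being
  proportional to the velocity \<open>(H 1 t, H 2 t)\<close>. What is left besides the bracket comes
  from the velocity turning at speed \<open>H 3 t\<close>.\<close>

lemma perp_deriv:
  assumes Z: "smooth Z" and t: "t \<in> {0..T}"
  shows "(perp Z has_real_derivative perp (lie_bracket V Z) t - H 3 t * tang Z t) (at t within {0..T})"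
  unfolding perp_def tang_def
  by (rule DERIV_cong, (rule derivative_intros coord_deriv[OF Z t] H_deriv[OF t])+)
    (simp add: algebra_simps)

abbreviation iter :: "nat \<Rightarrow> vfield \<Rightarrow> vfield" where
  "iter j W \<equiv> (lie_bracket V ^^ j) W"

lemma iter_Suc: "iter (j + 1) W = lie_bracket V (iter j W)"
  by (simp only: add_Suc_right One_nat_def add_0_right funpow.simps o_apply)

lemma smooth_iter: "smooth W \<Longrightarrow> smooth (iter j W)"
  by (induction j) (auto intro: smooth_lie_bracket smooth_V)

lemmas unique_Icc = real_derivative_unique_Icc[OF T_pos]

lemma derivative_zero_Icc:
  assumes "t \<in> {0..T}" "(f has_real_derivative d) (at t within {0..T})" "\<And>s. s \<in> {0..T} \<Longrightarrow> f s = 0"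
  shows "d = 0"
  by (rule unique_Icc[OF assms(1,2) DERIV_const assms(3)])

lemma coord_horizontal:
  assumes "horizontal X W"
  shows "coord 3 W t = 0" "coord 4 W t = 0" "coord 5 W t = 0"
  using assms unfolding horizontal_def by (blast intro: horizontal_expansion)+

text \<open>The components 3 to 5 of \<open>W\<close> vanish on the whole interval, hence so do
  their derivatives, and \<open>coord_deriv\<close> can be solved for the components of the bracket.
  The later iterates are found in the same way.\<close>

lemma coord_iter1:
  assumes W: "horizontal X W" and t: "t \<in> {0..T}"
  shows "coord 3 (iter 1 W) t = H 1 t * coord 2 W t - H 2 t * coord 1 W t"
    and "coord 4 (iter 1 W) t = 0" "coord 5 (iter 1 W) t = 0"
proof -
  have sW: "smooth W" using W by (simp add: horizontal_def)
  have i: "iter 1 W = lie_bracket V W"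
    using iter_Suc[of 0 W] by simp
  show "coord 3 (iter 1 W) t = H 1 t * coord 2 W t - H 2 t * coord 1 W t"
    using derivative_zero_Icc[OF t coord_deriv(1)[OF sW t] coord_horizontal(1)[OF W]]
      coord_horizontal(1)[OF W]
    unfolding i by simp
  show "coord 4 (iter 1 W) t = 0"
    using derivative_zero_Icc[OF t coord_deriv(2)[OF sW t] coord_horizontal(2)[OF W]]
      coord_horizontal(1)[OF W]
    unfolding i by simp
  show "coord 5 (iter 1 W) t = 0"
    using derivative_zero_Icc[OF t coord_deriv(3)[OF sW t] coord_horizontal(3)[OF W]]
      coord_horizontal(1)[OF W]
    unfolding i by simp
qed

lemma coord_iter2:
  assumes W: "horizontal X W" and t: "t \<in> {0..T}"
  shows "perp (iter 2 W) t = 0" and "tang (iter 2 W) t = coord 3 (iter 1 W) t"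
proof -
  have sW: "smooth (iter 1 W)" using W by (intro smooth_iter) (simp add: horizontal_def)
  have i: "iter 2 W = lie_bracket V (iter 1 W)"
    using iter_Suc[of 1 W] by simp
  have c: "coord 4 (iter 2 W) t = H 1 t * coord 3 (iter 1 W) t"
    "coord 5 (iter 2 W) t = H 2 t * coord 3 (iter 1 W) t"
    using derivative_zero_Icc[OF t coord_deriv(2)[OF sW t] coord_iter1(2)[OF W]]
      derivative_zero_Icc[OF t coord_deriv(3)[OF sW t] coord_iter1(3)[OF W]]
    unfolding i by simp_all
  show "perp (iter 2 W) t = 0" unfolding perp_def c by simp
  \<comment> \<open>The components 4 and 5 are a multiple of the velocity, so there is no
    perpendicular part, and unit speed makes the tangential part equal to the factor.\<close>
  have "tang (iter 2 W) t = ((H 1 t)\<^sup>2 + (H 2 t)\<^sup>2) * coord 3 (iter 1 W) t"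
    unfolding tang_def c by (simp add: algebra_simps power2_eq_square)
  then show "tang (iter 2 W) t = coord 3 (iter 1 W) t"
    by (simp add: speed_eq[OF t])
qed

lemma perp_iter3:
  assumes W: "horizontal X W" and t: "t \<in> {0..T}"
  shows "perp (iter 3 W) t = H 3 t * coord 3 (iter 1 W) t"
proof -
  have sW: "smooth (iter 2 W)" using W by (intro smooth_iter) (simp add: horizontal_def)
  have i: "iter 3 W = lie_bracket V (iter 2 W)"
    using iter_Suc[of 2 W] by simp
  have "perp (iter 3 W) t - H 3 t * tang (iter 2 W) t = 0"
    unfolding i by (rule derivative_zero_Icc[OF t perp_deriv[OF sW t] coord_iter2(1)[OF W]])
  then show ?thesis
    by (simp only: coord_iter2(2)[OF W t] right_minus_eq)
qed

text \<open>\<open>perp_iter3\<close> holds at all times and may be differentiated before the zero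
  is inserted. At the zero the product rule keeps only the derivative of \<open>H 3\<close>, and the
  correction term in \<open>perp_deriv\<close> vanishes as well.\<close>

lemma perp_iter4:
  assumes W: "horizontal X W" and t: "t \<in> {0..T}" and z: "H 3 t = 0"
  shows "perp (iter 4 W) t = (H 1 t * H 4 t + H 2 t * H 5 t) * coord 3 (iter 1 W) t"
proof -
  have s1: "smooth (iter 1 W)" and s3: "smooth (iter 3 W)"
    using W by (intro smooth_iter; simp add: horizontal_def)+
  have i: "iter 4 W = lie_bracket V (iter 3 W)"
    using iter_Suc[of 3 W] by simp
  show ?thesis
    using unique_Icc[OF t perp_deriv[OF s3 t] DERIV_mult[OF H_deriv(3)[OF t] coord_deriv(1)[OF s1 t]]
        perp_iter3[OF W]] z
    unfolding i by simp
qed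

lemma perp_iter_zero:
  assumes W: "horizontal X W" and z: "\<And>t. t \<in> {0..T} \<Longrightarrow> H 3 t = 0" and t: "t \<in> {0..T}"
  shows "perp (iter j W) t = 0"
  using t
proof (induction j arbitrary: t)
  case 0
  then show ?case by (simp add: perp_def coord_horizontal[OF W, unfolded o_apply])
next
  case (Suc j)
  have s: "smooth (iter j W)" using W by (intro smooth_iter) (simp add: horizontal_def)
  show ?case
    using derivative_zero_Icc[OF Suc.prems perp_deriv[OF s Suc.prems] Suc.IH] z[OF Suc.prems] by simp
qed

end

section \<open>The flag in an adapted frame\<close>

context normal_geodesic
begin

text \<open>The frame rotates \<open>X 4\<close>, \<open>X 5\<close> with the velocity and is
  numbered so that the flag spaces are spans of initial segments.\<close>

definition adapted :: "real \<Rightarrow> nat \<Rightarrow> real^5" where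
  "adapted t k =
    (if k = 4 then H 1 t *\<^sub>R X 4 (\<gamma> t) + H 2 t *\<^sub>R X 5 (\<gamma> t)
     else if k = 5 then - H 2 t *\<^sub>R X 4 (\<gamma> t) + H 1 t *\<^sub>R X 5 (\<gamma> t)
     else X k (\<gamma> t))"

text \<open>Unit speed makes the change from \<open>X 4\<close>, \<open>X 5\<close> to the last two
  adapted vectors a rotation, so \<open>tang\<close> and \<open>perp\<close> are the coordinates in
  them.\<close>

lemma adapted_expansion:
  assumes "t \<in> {0..T}"
  shows "Z (\<gamma> t) = coord 1 Z t *\<^sub>R adapted t 1 + coord 2 Z t *\<^sub>R adapted t 2 + coord 3 Z t *\<^sub>R adapted t 3
    + tang Z t *\<^sub>R adapted t 4 + perp Z t *\<^sub>R adapted t 5"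
proof -
  let ?c = "coord 4 Z t" and ?d = "coord 5 Z t"
  have "tang Z t *\<^sub>R adapted t 4 + perp Z t *\<^sub>R adapted t 5 =
      (tang Z t * H 1 t - perp Z t * H 2 t) *\<^sub>R X 4 (\<gamma> t) + (tang Z t * H 2 t + perp Z t * H 1 t) *\<^sub>R X 5 (\<gamma> t)"
    by (simp add: adapted_def algebra_simps)
  moreover have "tang Z t * H 1 t - perp Z t * H 2 t = ?c * ((H 1 t)\<^sup>2 + (H 2 t)\<^sup>2)"
    "tang Z t * H 2 t + perp Z t * H 1 t = ?d * ((H 1 t)\<^sup>2 + (H 2 t)\<^sup>2)"
    by (simp_all only: tang_def perp_def) (simp_all add: algebra_simps power2_eq_square)
  ultimately have "tang Z t *\<^sub>R adapted t 4 + perp Z t *\<^sub>R adapted t 5 = ?c *\<^sub>R X 4 (\<gamma> t) + ?d *\<^sub>R X 5 (\<gamma> t)"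
    using speed_eq[OF assms] by simp
  then have "coord 1 Z t *\<^sub>R adapted t 1 + coord 2 Z t *\<^sub>R adapted t 2 + coord 3 Z t *\<^sub>R adapted t 3
    + tang Z t *\<^sub>R adapted t 4 + perp Z t *\<^sub>R adapted t 5 =
    coord 1 Z t *\<^sub>R X 1 (\<gamma> t) + coord 2 Z t *\<^sub>R X 2 (\<gamma> t) + coord 3 Z t *\<^sub>R X 3 (\<gamma> t)
    + ?c *\<^sub>R X 4 (\<gamma> t) + ?d *\<^sub>R X 5 (\<gamma> t)"
    by (simp add: adapted_def add.assoc)
  then show ?thesis using frame_expansion[of "Z (\<gamma> t)" "\<gamma> t"] by simp
qed

lemma adapted_span: "t \<in> {0..T} \<Longrightarrow> span (adapted t ` {1..5}) = UNIV"
proof -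
  assume t: "t \<in> {0..T}"
  have "v \<in> span (adapted t ` {1..5})" for v
    by (subst adapted_expansion[OF t, of "\<lambda>_. v"]) (intro span_add span_scale span_base imageI; simp)
  then show ?thesis by blast
qed

lemma dim_adapted:
  assumes t: "t \<in> {0..T}" and n: "n \<le> 5"
  shows "dim (span (adapted t ` {1..n})) = n"
proof -
  have s: "{1..n} \<subseteq> {1..5}" using n by auto
  have "independent (adapted t ` {1..n})"
    by (rule independent_mono[OF spanning_five_independent(1)[OF adapted_span[OF t]] image_mono[OF s]])
  moreover have "card (adapted t ` {1..n}) = n"
    using card_image[OF inj_on_subset[OF spanning_five_independent(2)[OF adapted_span[OF t]] s]] by simp
  ultimately show ?thesis by (simp add: dim_eq_card_independent)
qed

lemma in_adapted_span:
  assumes t: "t \<in> {0..T}"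
  shows "coord 3 Z t = 0 \<Longrightarrow> coord 4 Z t = 0 \<Longrightarrow> coord 5 Z t = 0 \<Longrightarrow> Z (\<gamma> t) \<in> span (adapted t ` {1..2})"
    and "coord 4 Z t = 0 \<Longrightarrow> coord 5 Z t = 0 \<Longrightarrow> Z (\<gamma> t) \<in> span (adapted t ` {1..3})"
    and "perp Z t = 0 \<Longrightarrow> Z (\<gamma> t) \<in> span (adapted t ` {1..4})"
  by (subst adapted_expansion[OF t], simp only: tang_def perp_def mult_zero_right scale_zero_left add_0_right
      diff_self, intro span_add span_scale span_base imageI; simp)+

lemma flag_eq: "flag X T \<gamma> i t = span {iter j W (\<gamma> t) | W j. horizontal X W \<and> j < i}"
  by (simp add: flag_def flag_along_def V_def)

lemma iter_in_flag: "horizontal X W \<Longrightarrow> j < i \<Longrightarrow> iter j W (\<gamma> t) \<in> flag X T \<gamma> i t"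
  unfolding flag_eq by (rule span_base) blast

lemma subspace_flag: "subspace (flag X T \<gamma> i t)"
  unfolding flag_eq by (rule subspace_span)

lemma flag_subset:
  assumes "subspace S" "\<And>W j. horizontal X W \<Longrightarrow> j < i \<Longrightarrow> iter j W (\<gamma> t) \<in> S"
  shows "flag X T \<gamma> i t \<subseteq> S"
  unfolding flag_eq by (rule span_minimal) (use assms in auto)

text \<open>For the quarter turn of \<open>V\<close> the component is
  \<open>(H 1 t)\<^sup>2 + (H 2 t)\<^sup>2\<close>. With this normalisation \<open>perp\<close> of
  the third iterate is \<open>H 3\<close> itself and, at its zeros, \<open>perp\<close> of the
  fourth is the derivative of \<open>H 3\<close>.\<close>

lemma exists_unit_rotation:
  "\<exists>W. horizontal X W \<and> (\<forall>t\<in>{0..T}. coord 3 (iter 1 W) t = 1)"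
proof -
  define W where "W = (\<lambda>x. - (coframe 2 x \<bullet> V x) *\<^sub>R X 1 x + (coframe 1 x \<bullet> V x) *\<^sub>R X 2 x)"
  have W: "horizontal X W" unfolding W_def by (rule horizontal_rotation[OF horizontal_V])
  have "coord 3 (iter 1 W) t = 1" if t: "t \<in> {0..T}" for t
  proof -
    have c: "coord 1 W t = - H 2 t" "coord 2 W t = H 1 t"
      using coord_V[OF t] by (simp_all add: W_def inner_diff_right)
    show ?thesis
      unfolding coord_iter1(1)[OF W t] c using speed_eq[OF t] by (simp add: power2_eq_square)
  qed
  with W show ?thesis by blast
qed

text \<open>Triangular elimination: each iterate of \<open>W\<close> that is used has a nonzero
  coefficient at one new adapted vector, and its remaining terms, whatever their coefficients, are
  already in the flag.\<close>

lemma adapted_in_flag: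
  assumes t: "t \<in> {0..T}"
  shows "1 \<le> i \<Longrightarrow> k \<in> {1, 2} \<Longrightarrow> adapted t k \<in> flag X T \<gamma> i t"
    and "2 \<le> i \<Longrightarrow> adapted t 3 \<in> flag X T \<gamma> i t"
    and "3 \<le> i \<Longrightarrow> adapted t 4 \<in> flag X T \<gamma> i t"
    and "4 \<le> i \<Longrightarrow> H 3 t \<noteq> 0 \<Longrightarrow> adapted t 5 \<in> flag X T \<gamma> i t"
    and "5 \<le> i \<Longrightarrow> H 3 t = 0 \<Longrightarrow> H 1 t * H 4 t + H 2 t * H 5 t \<noteq> 0 \<Longrightarrow> adapted t 5 \<in> flag X T \<gamma> i t"
proof -
  note sub = subspace_add[OF subspace_flag] subspace_diff[OF subspace_flag] subspace_scale[OF subspace_flag]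
  obtain W where W: "horizontal X W" and f: "\<And>t. t \<in> {0..T} \<Longrightarrow> coord 3 (iter 1 W) t = 1"
    using exists_unit_rotation by blast
  show 12: "adapted t k \<in> flag X T \<gamma> i t" if "1 \<le> i" "k \<in> {1, 2}" for i k
    using that iter_in_flag[OF horizontal_X(1), of 0 i t] iter_in_flag[OF horizontal_X(2), of 0 i t]
    by (auto simp: adapted_def)
  show 3: "adapted t 3 \<in> flag X T \<gamma> i t" if "2 \<le> i" for i
  proof -
    let ?Z = "iter 1 W"
    have "tang ?Z t = 0" "perp ?Z t = 0"
      unfolding tang_def perp_def coord_iter1(2,3)[OF W t] by simp_all
    then have "adapted t 3 = ?Z (\<gamma> t) - (coord 1 ?Z t *\<^sub>R adapted t 1 + coord 2 ?Z t *\<^sub>R adapted t 2)"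
      using adapted_expansion[OF t, of ?Z] unfolding f[OF t] by (simp add: algebra_simps)
    also have "\<dots> \<in> flag X T \<gamma> i t"
      by (intro sub iter_in_flag[OF W] 12) (use that in auto)
    finally show ?thesis .
  qed
  show 4: "adapted t 4 \<in> flag X T \<gamma> i t" if "3 \<le> i" for i
  proof -
    let ?Z = "iter 2 W"
    have "tang ?Z t = 1" "perp ?Z t = 0"
      unfolding coord_iter2[OF W t] f[OF t] by simp_all
    then have "adapted t 4 = ?Z (\<gamma> t) - (coord 1 ?Z t *\<^sub>R adapted t 1 + coord 2 ?Z t *\<^sub>R adapted t 2
        + coord 3 ?Z t *\<^sub>R adapted t 3)"
      using adapted_expansion[OF t, of ?Z] by (simp add: algebra_simps)
    also have "\<dots> \<in> flag X T \<gamma> i t"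
      by (intro sub iter_in_flag[OF W] 12 3) (use that in auto)
    finally show ?thesis .
  qed
  have 5: "adapted t 5 \<in> flag X T \<gamma> i t" if "3 \<le> i" "j < i" "perp (iter j W) t \<noteq> 0" for i j
  proof -
    let ?Z = "iter j W"
    have "perp ?Z t *\<^sub>R adapted t 5 = ?Z (\<gamma> t) - (coord 1 ?Z t *\<^sub>R adapted t 1 + coord 2 ?Z t *\<^sub>R adapted t 2
        + coord 3 ?Z t *\<^sub>R adapted t 3 + tang ?Z t *\<^sub>R adapted t 4)"
      using adapted_expansion[OF t, of ?Z] by (simp add: algebra_simps)
    also have "\<dots> \<in> flag X T \<gamma> i t"
      by (intro sub iter_in_flag[OF W] 12 3 4) (use that in auto)
    finally have "(1 / perp ?Z t) *\<^sub>R perp ?Z t *\<^sub>R adapted t 5 \<in> flag X T \<gamma> i t"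
      by (rule sub)
    then show ?thesis using that by simp
  qed
  show "adapted t 5 \<in> flag X T \<gamma> i t" if "4 \<le> i" "H 3 t \<noteq> 0" for i
  proof (rule 5)
    show "perp (iter 3 W) t \<noteq> 0"
      unfolding perp_iter3[OF W t] f[OF t] using that by simp
  qed (use that in simp_all)
  show "adapted t 5 \<in> flag X T \<gamma> i t" if "5 \<le> i" "H 3 t = 0" "H 1 t * H 4 t + H 2 t * H 5 t \<noteq> 0" for i
  proof (rule 5)
    show "perp (iter 4 W) t \<noteq> 0"
      unfolding perp_iter4[OF W t that(2)] f[OF t] using that by simp
  qed (use that in simp_all)
qed

lemma adapted_span_subset_flag:
  assumes "\<And>k. k \<in> {1..n} \<Longrightarrow> adapted t k \<in> flag X T \<gamma> i t"
  shows "span (adapted t ` {1..n}) \<subseteq> flag X T \<gamma> i t"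
  by (rule span_minimal[OF _ subspace_flag]) (use assms in auto)

text \<open>The upper bounds must hold for every horizontal \<open>W\<close>, so they come from the
  component formulas; the lower bounds are \<open>adapted_in_flag\<close>.\<close>

lemma flag_small:
  assumes t: "t \<in> {0..T}"
  shows "flag X T \<gamma> 1 t = span (adapted t ` {1..2})"
    and "flag X T \<gamma> 2 t = span (adapted t ` {1..3})"
    and "flag X T \<gamma> 3 t = span (adapted t ` {1..4})"
    and "H 3 t = 0 \<Longrightarrow> flag X T \<gamma> 4 t = span (adapted t ` {1..4})"
proof -
  have split: "k \<in> {1..2} \<Longrightarrow> k = 1 \<or> k = 2" "k \<in> {1..3} \<Longrightarrow> k = 1 \<or> k = 2 \<or> k = 3"
    "k \<in> {1..4} \<Longrightarrow> k = 1 \<or> k = 2 \<or> k = 3 \<or> k = 4" for k :: nat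
    by auto
  have lt: "j < 1 \<Longrightarrow> j = 0" "j < 2 \<Longrightarrow> j = 0 \<or> j = 1" "j < 3 \<Longrightarrow> j = 0 \<or> j = 1 \<or> j = 2"
    "j < 4 \<Longrightarrow> j = 0 \<or> j = 1 \<or> j = 2 \<or> j = 3" for j :: nat
    by auto
  have i0: "iter 0 W = W" for W by simp
  have m1: "W (\<gamma> t) \<in> span (adapted t ` {1..2})" if "horizontal X W" for W
    by (rule in_adapted_span(1)[OF t, of W, OF coord_horizontal[OF that, of t]])
  have m2: "W (\<gamma> t) \<in> span (adapted t ` {1..3})" "iter 1 W (\<gamma> t) \<in> span (adapted t ` {1..3})"
    if "horizontal X W" for W
    by (rule in_adapted_span(2)[OF t, of W, OF coord_horizontal(2,3)[OF that, of t]],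
      rule in_adapted_span(2)[OF t, of "iter 1 W", OF coord_iter1(2,3)[OF that t]])
  have p: "perp W t = 0" "perp (iter 1 W) t = 0" if "horizontal X W" for W
    unfolding perp_def coord_horizontal[OF that] coord_iter1(2,3)[OF that t] by simp_all
  have m3: "W (\<gamma> t) \<in> span (adapted t ` {1..4})" "iter 1 W (\<gamma> t) \<in> span (adapted t ` {1..4})"
    "iter 2 W (\<gamma> t) \<in> span (adapted t ` {1..4})" if "horizontal X W" for W
    by (rule in_adapted_span(3)[OF t p(1)[OF that]], rule in_adapted_span(3)[OF t p(2)[OF that]],
      rule in_adapted_span(3)[OF t coord_iter2(1)[OF that t]])
  show "flag X T \<gamma> 1 t = span (adapted t ` {1..2})"
  proof
    show "flag X T \<gamma> 1 t \<subseteq> span (adapted t ` {1..2})"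
      by (rule flag_subset) (auto dest!: lt(1) simp only: i0 subspace_span m1)
    show "span (adapted t ` {1..2}) \<subseteq> flag X T \<gamma> 1 t"
      by (rule adapted_span_subset_flag, drule split(1)) (auto simp: adapted_in_flag[OF t] simp del: o_apply)
  qed
  show "flag X T \<gamma> 2 t = span (adapted t ` {1..3})"
  proof
    show "flag X T \<gamma> 2 t \<subseteq> span (adapted t ` {1..3})"
      by (rule flag_subset) (auto dest!: lt(2) simp only: i0 subspace_span m2)
    show "span (adapted t ` {1..3}) \<subseteq> flag X T \<gamma> 2 t"
      by (rule adapted_span_subset_flag, drule split(2)) (auto simp: adapted_in_flag[OF t] simp del: o_apply)
  qed
  show "flag X T \<gamma> 3 t = span (adapted t ` {1..4})"
  proof
    show "flag X T \<gamma> 3 t \<subseteq> span (adapted t ` {1..4})"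
      by (rule flag_subset) (auto dest!: lt(3) simp only: i0 subspace_span m3)
    show "span (adapted t ` {1..4}) \<subseteq> flag X T \<gamma> 3 t"
      by (rule adapted_span_subset_flag, drule split(3)) (auto simp: adapted_in_flag[OF t] simp del: o_apply)
  qed
  show "flag X T \<gamma> 4 t = span (adapted t ` {1..4})" if z: "H 3 t = 0"
  proof
    have "perp (iter 3 W) t = 0" if "horizontal X W" for W
      unfolding perp_iter3[OF that t] z by simp
    then have "iter 3 W (\<gamma> t) \<in> span (adapted t ` {1..4})" if "horizontal X W" for W
      by (rule in_adapted_span(3)[OF t]) (rule that)
    then show "flag X T \<gamma> 4 t \<subseteq> span (adapted t ` {1..4})"
      by (intro flag_subset) (auto dest!: lt(4) simp only: i0 subspace_span m3)
    show "span (adapted t ` {1..4}) \<subseteq> flag X T \<gamma> 4 t"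
      by (rule adapted_span_subset_flag, drule split(3)) (auto simp: adapted_in_flag[OF t] simp del: o_apply)
  qed
qed

lemma flag_full:
  assumes t: "t \<in> {0..T}" and i: "3 \<le> i" and a: "adapted t 5 \<in> flag X T \<gamma> i t"
  shows "flag X T \<gamma> i t = UNIV"
proof -
  have "adapted t k \<in> flag X T \<gamma> i t" if "k \<in> {1..5}" for k
  proof -
    have "k = 1 \<or> k = 2 \<or> k = 3 \<or> k = 4 \<or> k = 5" using that by auto
    then show ?thesis using i a adapted_in_flag(1)[OF t, of i k] adapted_in_flag(2,3)[OF t, of i]
      by (auto simp del: o_apply)
  qed
  from adapted_span_subset_flag[of 5, OF this] show ?thesis
    by (simp add: adapted_span[OF t] top.extremum_unique)
qed

text \<open>The \<open>LEAST\<close> in \<open>growth_vector\<close> also ranges over index 0, which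
  has to be excluded.\<close>

lemma growth_zero: "growth X T \<gamma> t 0 = 0"
  by (simp add: growth_def flag_eq)

lemma growth_small:
  assumes t: "t \<in> {0..T}"
  shows "growth X T \<gamma> t 1 = 2" "growth X T \<gamma> t 2 = 3" "growth X T \<gamma> t 3 = 4"
    and "H 3 t = 0 \<Longrightarrow> growth X T \<gamma> t 4 = 4"
  unfolding growth_def by (simp_all add: flag_small[OF t] dim_adapted[OF t] del: o_apply dim_span)

lemma growth_generic:
  assumes t: "t \<in> {0..T}" and "H 3 t \<noteq> 0" "4 \<le> i"
  shows "growth X T \<gamma> t i = 5"
  using flag_full[OF t, of i] adapted_in_flag(4)[OF t] assms by (simp add: growth_def del: o_apply)

lemma growth_singular:
  assumes t: "t \<in> {0..T}" and "H 3 t = 0" "H 1 t * H 4 t + H 2 t * H 5 t \<noteq> 0" "5 \<le> i"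
  shows "growth X T \<gamma> t i = 5"
  using flag_full[OF t, of i] adapted_in_flag(5)[OF t] assms by (simp add: growth_def del: o_apply)

lemma growth_vector_generic:
  assumes t: "t \<in> {0..T}" and z: "H 3 t \<noteq> 0"
  shows "growth_vector X T \<gamma> t = [2, 3, 4, 5]"
proof -
  have "(LEAST m. growth X T \<gamma> t m = 5) = 4"
  proof (rule Least_equality)
    show "growth X T \<gamma> t 4 = 5" by (rule growth_generic[OF t z]) simp
    show "4 \<le> m" if "growth X T \<gamma> t m = 5" for m
    proof (rule ccontr)
      assume "\<not> 4 \<le> m"
      then have "m = 0 \<or> m = 1 \<or> m = 2 \<or> m = 3" by auto
      then show False using that growth_small[OF t] growth_zero by auto
    qed
  qed
  moreover have "[1..<Suc 4] = [1, 2, 3, 4 :: nat]" by (simp add: upt_rec)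
  ultimately show ?thesis
    unfolding growth_vector_def using growth_small[OF t] growth_generic[OF t z, of 4] by simp
qed

lemma growth_vector_singular:
  assumes t: "t \<in> {0..T}" and z: "H 3 t = 0" "H 1 t * H 4 t + H 2 t * H 5 t \<noteq> 0"
  shows "growth_vector X T \<gamma> t = [2, 3, 4, 4, 5]"
proof -
  have "(LEAST m. growth X T \<gamma> t m = 5) = 5"
  proof (rule Least_equality)
    show "growth X T \<gamma> t 5 = 5" by (rule growth_singular[OF t z]) simp
    show "5 \<le> m" if "growth X T \<gamma> t m = 5" for m
    proof (rule ccontr)
      assume "\<not> 5 \<le> m"
      then have "m = 0 \<or> m = 1 \<or> m = 2 \<or> m = 3 \<or> m = 4" by auto
      then show False using that growth_small[OF t] growth_zero z by auto
    qed
  qed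
  moreover have "[1..<Suc 5] = [1, 2, 3, 4, 5 :: nat]" by (simp add: upt_rec)
  ultimately show ?thesis
    unfolding growth_vector_def using growth_small[OF t] growth_singular[OF t z, of 5] z by simp
qed

end

section \<open>Zeros of the vertical momentum\<close>

lemma Icc_derivative_interior:
  fixes f :: "real \<Rightarrow> real"
  assumes "\<And>t. t \<in> {a..b} \<Longrightarrow> (f has_real_derivative f' t) (at t within {a..b})" "a < t" "t < b"
  shows "(f has_real_derivative f' t) (at t)"
  using assms(1)[of t] assms(2,3) by (simp add: at_within_Icc_at)

text \<open>Integrating factors on both sides of \<open>t0\<close>:
  \<open>E s * exp (- K * s)\<close> decreases forwards and \<open>E s * exp (K * s)\<close>
  decreases backwards from the value 0.\<close>

lemma gronwall_zero:
  fixes E E' :: "real \<Rightarrow> real"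
  assumes d: "\<And>t. t \<in> {a..b} \<Longrightarrow> (E has_real_derivative E' t) (at t within {a..b})"
    and nonneg: "\<And>t. t \<in> {a..b} \<Longrightarrow> 0 \<le> E t"
    and bound: "\<And>t. t \<in> {a..b} \<Longrightarrow> \<bar>E' t\<bar> \<le> K * E t"
    and t0: "t0 \<in> {a..b}" "E t0 = 0" and t: "t \<in> {a..b}"
  shows "E t = 0"
proof -
  have cont: "continuous_on {a..b} E"
    using d by (rule DERIV_continuous_on)
  have D: "((\<lambda>s. E s * exp (c * s)) has_real_derivative (E' s + c * E s) * exp (c * s)) (at s)"
    if "a < s" "s < b" for c s
    by (rule derivative_eq_intros Icc_derivative_interior[OF d that] refl | assumption)+
      (simp add: algebra_simps)
  have C: "continuous_on {u..v} (\<lambda>s. E s * exp (c * s))" if "{u..v} \<subseteq> {a..b}" for u v c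
    using continuous_on_subset[OF cont that] by (intro continuous_intros)
  have "E t \<le> 0"
  proof (cases "t0 \<le> t")
    case True
    have "E t * exp (- K * t) \<le> E t0 * exp (- K * t0)"
    proof (rule DERIV_nonpos_imp_decreasing_open[OF True])
      show "\<exists>y. ((\<lambda>s. E s * exp (- K * s)) has_real_derivative y) (at s) \<and> y \<le> 0"
        if "t0 < s" "s < t" for s
        using D[of s "- K"] bound[of s] that t0 t
        by (intro exI conjI) (auto intro!: mult_nonpos_nonneg)
    qed (use C[of t0 t "- K"] t0 t in auto)
    then show ?thesis using t0 by (simp add: mult_le_0_iff)
  next
    case False
    then have le: "t \<le> t0" by simp
    have "E t * exp (K * t) \<le> E t0 * exp (K * t0)"
    proof (rule DERIV_nonneg_imp_increasing_open[OF le])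
      show "\<exists>y. ((\<lambda>s. E s * exp (K * s)) has_real_derivative y) (at s) \<and> 0 \<le> y"
        if "t < s" "s < t0" for s
        using D[of s "K"] bound[of s] that t0 t
        by (intro exI conjI) (auto intro!: mult_nonneg_nonneg)
    qed (use C[of t t0 K] t0 t in auto)
    then show ?thesis using t0 by (simp add: mult_le_0_iff)
  qed
  with nonneg[OF t] show ?thesis by simp
qed

context normal_geodesic
begin

text \<open>
  With \<open>d = h 1 h 4 + h 2 h 5\<close> and \<open>c = h 1 h 5 - h 2 h 4\<close>, the pendulum equation reads
  \<open>h 3' = d\<close>, \<open>d' = c h 3\<close>, so a common zero of \<open>h 3\<close> and \<open>d\<close> propagates to all times.
\<close>

lemma H3_simple_zeros:
  assumes t0: "t0 \<in> {0..T}" "H 3 t0 = 0" and s: "s \<in> {0..T}" "H 3 s \<noteq> 0"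
  shows "H 1 t0 * H 4 t0 + H 2 t0 * H 5 t0 \<noteq> 0"
proof
  assume z: "H 1 t0 * H 4 t0 + H 2 t0 * H 5 t0 = 0"
  define d where "d t = H 1 t * H 4 t + H 2 t * H 5 t" for t
  define c where "c t = H 1 t * H 5 t - H 2 t * H 4 t" for t
  have d: "(d has_real_derivative c t * H 3 t) (at t within {0..T})" if "t \<in> {0..T}" for t
    unfolding d_def[abs_def] c_def
    by (rule DERIV_cong, (rule derivative_intros H_deriv[OF that])+) (simp add: algebra_simps)
  have H3: "((\<lambda>t. H 3 t) has_real_derivative d t) (at t within {0..T})" if "t \<in> {0..T}" for t
    using H_deriv(3)[OF that] by (simp only: d_def)
  \<comment> \<open>This energy detects a common zero. Since 2|xy| \<le> x^2 + y^2 and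
    \<open>c\<close> is bounded on the compact interval, its derivative is bounded by a multiple of
    it, as \<open>gronwall_zero\<close> demands.\<close>
  have E: "((\<lambda>t. (H 3 t)\<^sup>2 + (d t)\<^sup>2) has_real_derivative 2 * H 3 t * d t * (1 + c t)) (at t within {0..T})"
    if "t \<in> {0..T}" for t
    by (rule DERIV_cong, (rule derivative_intros H3[OF that] d[OF that])+) (simp add: algebra_simps)
  have "continuous_on {0..T} c"
    unfolding c_def[abs_def] by (intro continuous_intros H_deriv[THEN DERIV_continuous_on])
  then have "compact (c ` {0..T})" by (rule compact_continuous_image) simp
  then have "bounded (c ` {0..T})" by (rule compact_imp_bounded)
  then obtain K where K: "\<And>t. t \<in> {0..T} \<Longrightarrow> \<bar>c t\<bar> \<le> K"
    unfolding bounded_iff by (metis imageI real_norm_def)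
  have "(H 3 s)\<^sup>2 + (d s)\<^sup>2 = 0"
  proof (rule gronwall_zero[OF E _ _ t0(1) _ s(1)])
    fix t assume t: "t \<in> {0..T}"
    have "\<bar>2 * H 3 t * d t\<bar> \<le> (H 3 t)\<^sup>2 + (d t)\<^sup>2"
      using sum_squares_bound[of "\<bar>H 3 t\<bar>" "\<bar>d t\<bar>"] by (simp add: abs_mult)
    moreover have "\<bar>1 + c t\<bar> \<le> 1 + K" using K[OF t] by simp
    ultimately have "\<bar>2 * H 3 t * d t\<bar> * \<bar>1 + c t\<bar> \<le> ((H 3 t)\<^sup>2 + (d t)\<^sup>2) * (1 + K)"
      by (rule mult_mono) auto
    then show "\<bar>2 * H 3 t * d t * (1 + c t)\<bar> \<le> (1 + K) * ((H 3 t)\<^sup>2 + (d t)\<^sup>2)"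
      by (simp add: abs_mult mult.commute)
  qed (use t0 z in \<open>simp_all add: d_def\<close>)
  then show False using s(2) by (simp add: sum_power2_eq_zero_iff)
qed

text \<open>Nonvanishing of \<open>H 3\<close> persists nearby by continuity. Conversely a zero is
  simple, hence isolated, so the fourth growth number is 4 at the zero and 5 at all nearby
  times.\<close>

lemma equiregular_iff:
  assumes t: "t \<in> {0..T}" and s: "s \<in> {0..T}" "H 3 s \<noteq> 0"
  shows "equiregular_at X T \<gamma> t \<longleftrightarrow> H 3 t \<noteq> 0"
proof
  have inside: "\<forall>\<^sub>F s in at t within {0..T}. s \<in> {0..T}"
    by (simp add: eventually_at_filter)
  assume nz: "H 3 t \<noteq> 0"
  have "continuous_on {0..T} (H 3)"
    by (rule DERIV_continuous_on) (rule H_deriv(3))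
  then have "(H 3 \<longlongrightarrow> H 3 t) (at t within {0..T})"
    using t by (simp add: continuous_on)
  then have "\<forall>\<^sub>F s in at t within {0..T}. H 3 s \<noteq> 0"
    using nz by (rule tendsto_imp_eventually_ne)
  with inside show "equiregular_at X T \<gamma> t"
    unfolding equiregular_at_def
  proof eventually_elim
    case (elim r)
    show ?case
    proof (intro allI impI)
      fix i :: nat assume "1 \<le> i"
      then consider "i = 1" | "i = 2" | "i = 3" | "4 \<le> i" by linarith
      then show "growth X T \<gamma> r i = growth X T \<gamma> t i"
        by cases (simp_all add: growth_small[OF elim(1)] growth_small[OF t]
            growth_generic[OF elim] growth_generic[OF t nz] del: o_apply)
    qed
  qed
next
  assume eq: "equiregular_at X T \<gamma> t"
  show "H 3 t \<noteq> 0"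
  proof
    assume z: "H 3 t = 0"
    have inside: "\<forall>\<^sub>F s in at t within {0..T}. s \<in> {0..T}"
      by (simp add: eventually_at_filter)
    have "((\<lambda>s. (H 3 s - H 3 t) / (s - t)) \<longlongrightarrow> H 1 t * H 4 t + H 2 t * H 5 t) (at t within {0..T})"
      using H_deriv(3)[OF t] by (simp only: has_field_derivative_iff)
    then have "\<forall>\<^sub>F s in at t within {0..T}. (H 3 s - H 3 t) / (s - t) \<noteq> 0"
      using H3_simple_zeros[OF t z s] by (rule tendsto_imp_eventually_ne)
    with inside eq[unfolded equiregular_at_def] have "\<forall>\<^sub>F s in at t within {0..T}. False"
    proof eventually_elim
      case (elim r)
      have "H 3 r \<noteq> 0" using elim(3) z by auto
      then have "growth X T \<gamma> r 4 = 5" using growth_generic[OF elim(1)] by blast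
      moreover have "growth X T \<gamma> r 4 = growth X T \<gamma> t 4" using elim(2) by simp
      ultimately show False using growth_small(4)[OF t z] by simp
    qed
    \<comment> \<open>The contradiction is only an eventual one; nearby times different from
      \<open>t\<close> exist, also at the end points, because \<open>T\<close> is positive.\<close>
    moreover have "at t within {0..T} \<noteq> bot"
      using t T_pos by (simp add: trivial_limit_within islimpt_Icc)
    ultimately show False by (simp add: trivial_limit_def)
  qed
qed

lemma ample_nonzero:
  assumes s: "s \<in> {0..T}" "H 3 s \<noteq> 0"
  shows "ample X T \<gamma>"
  unfolding ample_def
proof
  fix t assume t: "t \<in> {0..T}"
  have "adapted t 5 \<in> flag X T \<gamma> 5 t"
    using adapted_in_flag(4,5)[OF t, of 5] H3_simple_zeros[OF t _ s] by fastforce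
  from flag_full[OF t _ this] show "ample_at X T \<gamma> t"
    unfolding ample_at_def by (intro exI[of _ 5]) simp
qed

text \<open>Every iterate has vanishing \<open>perp\<close>, so all flag spaces stay in one
  hyperplane. Time 0 is enough, since ampleness is required at all times.\<close>

lemma not_ample_zero:
  assumes z: "\<And>t. t \<in> {0..T} \<Longrightarrow> H 3 t = 0"
  shows "\<not> ample X T \<gamma>"
proof
  assume "ample X T \<gamma>"
  moreover have t: "0 \<in> {0..T}" using T_pos by simp
  ultimately obtain m where m: "flag X T \<gamma> m 0 = UNIV"
    unfolding ample_def ample_at_def by blast
  have "flag X T \<gamma> m 0 \<subseteq> span (adapted 0 ` {1..4})"
    by (rule flag_subset) (simp, rule in_adapted_span(3)[OF t], rule perp_iter_zero[OF _ z t])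
  with m have "dim (span (adapted 0 ` {1..4})) = dim (UNIV :: (real^5) set)"
    by (simp add: top.extremum_unique)
  then show False using dim_adapted[OF t, of 4] by simp
qed

section \<open>The abnormal lift\<close>

text \<open>Vanishing \<open>H 3\<close> freezes the velocity components at \<open>a\<close> and
  \<open>b\<close>. The covector then has constant coefficients in the coframe, so it extends to a
  smooth one-form \<open>s\<close> on the whole space, and the lift is the graph of \<open>s\<close>
  over the curve.\<close>

lemma abnormal_zero:
  assumes z: "\<And>t. t \<in> {0..T} \<Longrightarrow> H 3 t = 0"
  shows "abnormal X T \<gamma>"
proof -
  define a b where "a = H 1 0" and "b = H 2 0"
  have const: "H 1 t = a" "H 2 t = b" if t: "t \<in> {0..T}" for t
  proof -
    have "\<exists>c. \<forall>t\<in>{0..T}. H i t = c" if "i \<in> {1, 2}" for i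
      by (rule has_field_derivative_zero_constant) (use that H_deriv(1,2) z in fastforce)+
    then show "H 1 t = a" "H 2 t = b"
      unfolding a_def b_def using t T_pos by (metis atLeastAtMost_iff insertCI less_eq_real_def order_refl)+
  qed
  have ab: "a\<^sup>2 + b\<^sup>2 = 1" using speed_eq[of 0] T_pos by (simp add: a_def b_def)
  define s where "s x = (- b) *\<^sub>R coframe 4 x + a *\<^sub>R coframe 5 x" for x
  define g where "g x = (x, s x)" for x
  have ss: "smooth s" unfolding s_def by (intro smooth_add smooth_scaleR smooth_const smooth_coframe)
  have sg: "smooth g" unfolding g_def by (intro smooth_Pair smooth_ident ss)
  have Dg: "frechet_derivative g (at x) v = (v, frechet_derivative s (at x) v)" for x v
    unfolding g_def
    by (rule fun_cong[OF frechet_derivative_at[symmetric]])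
      (intro has_derivative_Pair has_derivative_ident smooth_has_derivative ss)
  have Ds: "frechet_derivative s (at x) v =
      (- b) *\<^sub>R frechet_derivative (coframe 4) (at x) v + a *\<^sub>R frechet_derivative (coframe 5) (at x) v" for x v
    unfolding s_def
    by (rule fun_cong[OF frechet_derivative_at[symmetric]])
      (intro has_derivative_add has_derivative_scaleR_right smooth_has_derivative smooth_coframe)
  define w where "w t = frechet_derivative g (at (\<gamma> t)) (V (\<gamma> t))" for t
  have deriv: "((\<lambda>t. g (\<gamma> t)) has_vector_derivative w t) (at t within {0..T})" if t: "t \<in> {0..T}" for t
    using has_derivative_compose[OF geodesic_has_derivative[OF t] smooth_has_derivative[OF sg]]
    unfolding has_vector_derivative_def w_def linear_scale[OF smooth_linear_derivative[OF sg]] .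
  have "continuous_on {0..T} \<gamma>"
    using geodesic_has_derivative by (rule has_derivative_continuous_on)
  then have "continuous_on {0..T} w"
    unfolding w_def
    by (rule continuous_on_compose2[OF smooth_continuous_on[OF
          smooth_directional_derivative[OF sg smooth_ident smooth_V]]]) auto
  then have "bounded (w ` {0..T})"
    by (intro compact_imp_bounded compact_continuous_image) auto
  then obtain C where C: "C > 0" "\<And>t. t \<in> {0..T} \<Longrightarrow> norm (w t) \<le> C"
    unfolding bounded_pos by auto
  \<comment> \<open>The constant bounds the continuous velocity \<open>w\<close> of the lift on the
    compact interval.\<close>
  have "C-lipschitz_on {0..T} (\<lambda>t. g (\<gamma> t))"
  proof (rule bounded_derivative_imp_lipschitz)
    show "((\<lambda>t. g (\<gamma> t)) has_derivative (\<lambda>r. r *\<^sub>R w t)) (at t within {0..T})" if "t \<in> {0..T}" for t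
      using deriv[OF that] by (simp only: has_vector_derivative_def)
    show "onorm (\<lambda>r. r *\<^sub>R w t) \<le> C" if "t \<in> {0..T}" for t
      by (rule onorm_bound) (use C(1) C(2)[OF that] in \<open>auto simp: mult.commute[of C] intro: mult_left_mono\<close>)
  qed (use C in auto)
  moreover have "fst (g (\<gamma> t)) = \<gamma> t" for t by (simp add: g_def)
  moreover have "snd (g (\<gamma> t)) \<noteq> 0" for t
  proof
    assume "snd (g (\<gamma> t)) = 0"
    then have "s (\<gamma> t) \<bullet> X 4 (\<gamma> t) = 0" "s (\<gamma> t) \<bullet> X 5 (\<gamma> t) = 0" by (simp_all add: g_def)
    then have "a = 0" "b = 0" by (simp_all add: s_def inner_diff_left)
    with ab show False by simp
  qed
  moreover have "h X 1 (g x) = 0" "h X 2 (g x) = 0" for x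
    by (simp_all add: h_def g_def s_def inner_diff_left)
  moreover have "((\<lambda>t. g (\<gamma> t)) has_vector_derivative
      a *\<^sub>R hamiltonian_field (h X 1) (g (\<gamma> t)) + b *\<^sub>R hamiltonian_field (h X 2) (g (\<gamma> t)))
      (at t within {0..T})" if t: "t \<in> {0..T}" for t
  proof -
    let ?x = "\<gamma> t" and ?D = "\<lambda>i. frechet_derivative (X i) (at (\<gamma> t))"
    have V: "V ?x = a *\<^sub>R X 1 ?x + b *\<^sub>R X 2 ?x"
      using V_geodesic[OF t] by (simp only: const[OF t])
    have Vs: "V ?x \<in> span {X 1 ?x, X 2 ?x}"
      using horizontal_V unfolding horizontal_def by blast
    have pair: "frechet_derivative (coframe k) (at ?x) v \<bullet> X i ?x = - (coframe k ?x \<bullet> ?D i v)"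
      if "k \<in> {1..5}" "i \<in> {1, 2}" for k i v
      using coframe_pairing_constant[of "X i" k "if k = i then 1 else 0" ?x v, OF smooth_X coframe_X] that
      by (auto simp: eq_neg_iff_add_eq_0 add.commute)
    have "frechet_derivative s (at ?x) (V ?x) = - (a *\<^sub>R adjoint (?D 1) (s ?x) + b *\<^sub>R adjoint (?D 2) (s ?x))"
    proof (rule vector_eq_ldot[THEN iffD1], rule allI)
      fix v
      let ?E = "\<lambda>k. frechet_derivative (coframe k) (at ?x)"
      \<comment> \<open>Swapping the two arguments costs \<open>dcoframe\<close>. The derivative in
        direction \<open>v\<close> is then moved from the coframe to the \<open>X i\<close>, which
        produces the adjoint terms of Hamilton's equations.\<close>
      have "?E k (V ?x) \<bullet> v = dcoframe k ?x (V ?x) v - (a * (coframe k ?x \<bullet> ?D 1 v) + b * (coframe k ?x \<bullet> ?D 2 v))"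
        if "k \<in> {1..5}" for k
      proof -
        have "?E k v \<bullet> V ?x = - (a * (coframe k ?x \<bullet> ?D 1 v) + b * (coframe k ?x \<bullet> ?D 2 v))"
          using pair[OF that, of 1 v] pair[OF that, of 2 v]
          by (simp only: V inner_add_right inner_scaleR_right) simp
        then show ?thesis by (simp only: dcoframe_def)
      qed
      \<comment> \<open>By the structure equations the two terms are a b \<theta>3(v) and -a b
        \<theta>3(v), with \<theta>3 for \<open>coframe 3\<close>: the velocity lies in the kernel
        of the exterior derivative of \<open>s\<close>.\<close>
      moreover have "- b * dcoframe 4 ?x (V ?x) v + a * dcoframe 5 ?x (V ?x) v = 0"
        using dcoframe_horizontal(2,3)[OF Vs] coord_V[OF t] const[OF t] by simp
      ultimately show "v \<bullet> frechet_derivative s (at ?x) (V ?x) =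
          v \<bullet> - (a *\<^sub>R adjoint (?D 1) (s ?x) + b *\<^sub>R adjoint (?D 2) (s ?x))"
        by (simp add: Ds inner_add_right inner_diff_right
            adjoint_works[OF smooth_linear_derivative[OF smooth_X12(1)]]
            adjoint_works[OF smooth_linear_derivative[OF smooth_X12(2)]]
            inner_commute[of v] inner_commute[of _ "s _"])
          (simp add: s_def inner_diff_left algebra_simps)
    qed
    then show ?thesis
      using deriv[OF t] by (simp add: w_def Dg hamiltonian_field_h smooth_X12 V[unfolded o_apply] g_def)
  qed
  moreover have "(\<gamma> has_vector_derivative a *\<^sub>R X 1 (\<gamma> t) + b *\<^sub>R X 2 (\<gamma> t)) (at t within {0..T})"
    if t: "t \<in> {0..T}" for t
    using geodesic_deriv[OF t] by (simp only: const[OF t])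
  ultimately show ?thesis
    unfolding abnormal_def
    by (intro exI[of _ "\<lambda>_. a"] exI[of _ "\<lambda>_. b"] exI[of _ "\<lambda>t. g (\<gamma> t)"] exI[of _ C] conjI ballI)
      (auto intro!: AE_I2)
qed

end

theorem proposition6p1:
  fixes gmul :: "real^5 \<Rightarrow> real^5 \<Rightarrow> real^5" and e :: "real^5" and ginv :: "real^5 \<Rightarrow> real^5"
    and X :: "nat \<Rightarrow> real^5 \<Rightarrow> real^5"
    and T :: real and l :: "real \<Rightarrow> (real^5) \<times> (real^5)" and \<gamma> :: "real \<Rightarrow> real^5"
  assumes "cartan_group gmul e ginv X"
    and "0 < T"
    and "normal_extremal X T l"
    and "unit_speed X T l"
    and "\<gamma> = fst \<circ> l"
  shows "((\<exists>t\<in>{0..T}. h X 3 (l t) \<noteq> 0) \<longrightarrow>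
            (\<forall>t\<in>{0..T}. equiregular_at X T \<gamma> t \<longleftrightarrow> h X 3 (l t) \<noteq> 0) \<and>
            ample X T \<gamma> \<and>
            (\<forall>t\<in>{0..T}. growth_vector X T \<gamma> t =
               (if h X 3 (l t) \<noteq> 0 then [2, 3, 4, 5] else [2, 3, 4, 4, 5]))) \<and>
         ((\<forall>t\<in>{0..T}. h X 3 (l t) = 0) \<longrightarrow>
            \<not> ample X T \<gamma> \<and> abnormal X T \<gamma>)"
proof -
  interpret normal_geodesic gmul e ginv X T l
    using assms(1-4) by (simp add: normal_geodesic_def normal_geodesic_axioms_def)
  show ?thesis
    unfolding assms(5)
  proof (intro conjI impI)
    assume "\<exists>t\<in>{0..T}. h X 3 (l t) \<noteq> 0"
    then obtain s where s: "s \<in> {0..T}" "h X 3 (l s) \<noteq> 0" by blast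
    show "\<forall>t\<in>{0..T}. equiregular_at X T (fst \<circ> l) t \<longleftrightarrow> h X 3 (l t) \<noteq> 0"
      using equiregular_iff[OF _ s] by blast
    show "ample X T (fst \<circ> l)" by (rule ample_nonzero[OF s])
    show "\<forall>t\<in>{0..T}. growth_vector X T (fst \<circ> l) t =
        (if h X 3 (l t) \<noteq> 0 then [2, 3, 4, 5] else [2, 3, 4, 4, 5])"
      using growth_vector_generic growth_vector_singular H3_simple_zeros[OF _ _ s] by simp
  next
    assume "\<forall>t\<in>{0..T}. h X 3 (l t) = 0"
    then show "\<not> ample X T (fst \<circ> l)" "abnormal X T (fst \<circ> l)"
      using not_ample_zero abnormal_zero by blast+
  qed
qed

end
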